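(* Suppose Assumption 1 holds. Then: (i) $A:=\mathbb{E}[\phi(a,x)(\beta\phi(a',x')-\phi(a,x))^\intercal]$ is invertible, so $\omega^*:=\mathbb{E}\left[\phi(a,x)\left(\phi(a,x)-\beta\phi(a',x')\right)^\intercal\right]^{-1}\mathbb{E}[\phi(a,x)z(a,x)]$ exists; and with probability approaching one (as $n\to\infty$) the matrix $\mathbb{E}_n\left[\phi(a,x)\left(\phi(a,x)-\beta\phi(a',x')\right)^\intercal\right]$ is invertible, so that $\hat\omega:=\mathbb{E}_n\left[\phi(a,x)\left(\phi(a,x)-\beta\phi(a',x')\right)^\intercal\right]^{-1}\mathbb{E}_n[\phi(a,x)z(a,x)]$ exists. (ii) $\left\|h-\phi^\intercal\omega^*\right\|_2\le(1-\beta)^{-1}\left\|h-P_\phi[h]\right\|_2\le C(1-\beta)^{-1}k_\phi^{-\alpha}$, with $C,\alpha$ from Assumption 1(iii). (iii) $\left|\hat\omega-\omega^*\right|=O_p\big(\sqrt{k_\phi/n}\big)$. (iv) $\left\|h-\phi^\intercal\hat\omega\right\|_2=O_p\left(\frac{k_\phi}{\sqrt n}+k_\phi^{-\alpha}\right)$.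
   Context: Setup. $\mathcal{A}$ is a finite action set, $\mathcal{X}$ a state space, $\beta\in(0,1)$ a discount factor. Data: $n$ i.i.d. individuals $i=1,\dots,n$, each observed over a fixed number $T\ge2$ of periods, $(a_{it},x_{it})_{t=1}^T$, forming a stationary Markov chain whose transition law does not depend on $t$; $\mathbb{P}$ denotes the common joint law of $(a,x,a',x'):=(a_{it},x_{it},a_{i,t+1},x_{i,t+1})$ (so $(a',x')$ has the same marginal law as $(a,x)$), and $\mathbb{E}$ its expectation. The empirical expectation is $\mathbb{E}_n[f(a,x,a',x')]:=(n(T-1))^{-1}\sum_{i=1}^n\sum_{t=1}^{T-1}f(a_{it},x_{it},a_{i,t+1},x_{i,t+1})$. For $f:\mathcal{A}\times\mathcal{X}\to\mathbb{R}$, $\|f\|_2:=\mathbb{E}[|f(a,x)|^2]^{1/2}$; $|\cdot|$ is the Euclidean norm. $z:\mathcal{A}\times\mathcal{X}\to\mathbb{R}$ is a known function, and $h$ is the unique fixed point of $\Gamma_z[f](a,x):=z(a,x)+\beta\mathbb{E}[f(a',x')\mid a,x]$. $\phi:\mathcal{A}\times\mathcal{X}\to\mathbb{R}^{k_\phi}$ is a vector of basis functions whose dimension $k_\phi$ may grow with $n$, and $P_\phi[f]:=\phi^\intercal\mathbb{E}[\phi\phi^\intercal]^{-1}\mathbb{E}[\phi f]$. Assumption 1: (i) the components of $\phi$ are linearly independent ($\phi(a,x)^\intercal\omega=0$ for all $(a,x)$ iff $\omega=0$) and the eigenvalues of $\mathbb{E}[\phi(a,x)\phi(a,x)^\intercal]$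 are bounded away from zero uniformly in $k_\phi$; (ii) each component of $\phi$ is bounded in absolute value by a constant $M<\infty$ independent of $k_\phi$; (iii) there exist $C<\infty$ and $\alpha>0$ with $\|h-P_\phi[h]\|_2\le Ck_\phi^{-\alpha}$; (iv) the domain of $(a,x)$ is compact and $\sup_{a,x}|z(a,x)|\le L<\infty$; (v) $k_\phi\to\infty$ and $k_\phi^2/n\to0$ as $n\to\infty$. *)

theory Defs
  imports "HOL-Probability.Probability" "Jordan_Normal_Form.Char_Poly"
begin

text \<open>Inverse of a square matrix (the zero matrix if it is singular; only used
  where invertibility holds or is asserted).\<close>
definition minv :: "real mat \<Rightarrow> real mat" where
  "minv A = (if invertible_mat A then (SOME B. inverts_mat A B \<and> inverts_mat B A)
             else 0\<^sub>m (dim_row A) (dim_col A))"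

definition eucl_norm :: "real vec \<Rightarrow> real" where
  "eucl_norm v = sqrt (\<Sum>j<dim_vec v. (v $ j)\<^sup>2)"

definition L2norm :: "'s measure \<Rightarrow> ('s \<Rightarrow> real) \<Rightarrow> real" where
  "L2norm mu f = sqrt (\<integral>s. (f s)\<^sup>2 \<partial>mu)"

text \<open>Expectation under the joint law P of (s, s') = ((a,x),(a',x')):
  s ~ mu, s' ~ K s.\<close>
definition Epair :: "'s measure \<Rightarrow> ('s \<Rightarrow> 's measure) \<Rightarrow> ('s \<Rightarrow> 's \<Rightarrow> real) \<Rightarrow> real" where
  "Epair mu K f = (\<integral>s. (\<integral>s'. f s s' \<partial>K s) \<partial>mu)"

text \<open>Iterated kernel integral: chain_fun K [f0,...,f_{m-1}] s
  = E[f0(s_0) ... f_{m-1}(s_{m-1}) | s_0 = s] for the Markov chain with kernel K.\<close>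
fun chain_fun :: "('s \<Rightarrow> 's measure) \<Rightarrow> ('s \<Rightarrow> real) list \<Rightarrow> 's \<Rightarrow> real" where
  "chain_fun K [] s = 1"
| "chain_fun K (f # fs) s = f s * (\<integral>s'. chain_fun K fs s' \<partial>K s)"

definition lincomb :: "nat \<Rightarrow> (nat \<Rightarrow> 's \<Rightarrow> real) \<Rightarrow> real vec \<Rightarrow> 's \<Rightarrow> real" where
  "lincomb k ph w s = (\<Sum>j<k. ph j s * w $ j)"

definition Gram :: "'s measure \<Rightarrow> nat \<Rightarrow> (nat \<Rightarrow> 's \<Rightarrow> real) \<Rightarrow> real mat" where
  "Gram mu k ph = mat k k (\<lambda>(i,j). \<integral>s. ph i s * ph j s \<partial>mu)"

definition Pphi :: "'s measure \<Rightarrow> nat \<Rightarrow> (nat \<Rightarrow> 's \<Rightarrow> real) \<Rightarrow> ('s \<Rightarrow> real) \<Rightarrow> 's \<Rightarrow> real" where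
  "Pphi mu k ph f = lincomb k ph (minv (Gram mu k ph) *\<^sub>v vec k (\<lambda>i. \<integral>s. ph i s * f s \<partial>mu))"

definition Amat :: "'s measure \<Rightarrow> ('s \<Rightarrow> 's measure) \<Rightarrow> real \<Rightarrow> nat \<Rightarrow> (nat \<Rightarrow> 's \<Rightarrow> real) \<Rightarrow> real mat" where
  "Amat mu K \<beta> k ph = mat k k (\<lambda>(i,j). Epair mu K (\<lambda>s s'. ph i s * (\<beta> * ph j s' - ph j s)))"

definition omega_star :: "'s measure \<Rightarrow> ('s \<Rightarrow> 's measure) \<Rightarrow> real \<Rightarrow> nat \<Rightarrow> (nat \<Rightarrow> 's \<Rightarrow> real) \<Rightarrow> ('s \<Rightarrow> real) \<Rightarrow> real vec" where
  "omega_star mu K \<beta> k ph z =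
     minv (mat k k (\<lambda>(i,j). Epair mu K (\<lambda>s s'. ph i s * (ph j s - \<beta> * ph j s'))))
       *\<^sub>v vec k (\<lambda>i. \<integral>s. ph i s * z s \<partial>mu)"

text \<open>Empirical expectation E_n over the first n individuals and the T-1 transitions:
  (n(T-1))^{-1} sum_{i<n} sum_{t<T-1} f(Y i t, Y i (t+1)).\<close>
definition En :: "(nat \<Rightarrow> nat \<Rightarrow> 'w \<Rightarrow> 's) \<Rightarrow> nat \<Rightarrow> nat \<Rightarrow> 'w \<Rightarrow> ('s \<Rightarrow> 's \<Rightarrow> real) \<Rightarrow> real" where
  "En Y T n \<omega> f = (\<Sum>i<n. \<Sum>t<T - 1. f (Y i t \<omega>) (Y i (Suc t) \<omega>)) / (real n * real (T - 1))"

definition Bhat :: "(nat \<Rightarrow> nat \<Rightarrow> 'w \<Rightarrow> 's) \<Rightarrow> nat \<Rightarrow> real \<Rightarrow> nat \<Rightarrow> (nat \<Rightarrow> 's \<Rightarrow> real) \<Rightarrow> nat \<Rightarrow> 'w \<Rightarrow> real mat" where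
  "Bhat Y T \<beta> k ph n \<omega> = mat k k (\<lambda>(i,j). En Y T n \<omega> (\<lambda>s s'. ph i s * (ph j s - \<beta> * ph j s')))"

text \<open>omega-hat (only meaningful on the event where Bhat is invertible).\<close>
definition omega_hat :: "(nat \<Rightarrow> nat \<Rightarrow> 'w \<Rightarrow> 's) \<Rightarrow> nat \<Rightarrow> real \<Rightarrow> nat \<Rightarrow> (nat \<Rightarrow> 's \<Rightarrow> real) \<Rightarrow> ('s \<Rightarrow> real) \<Rightarrow> nat \<Rightarrow> 'w \<Rightarrow> real vec" where
  "omega_hat Y T \<beta> k ph z n \<omega> =
     minv (Bhat Y T \<beta> k ph n \<omega>) *\<^sub>v vec k (\<lambda>i. En Y T n \<omega> (\<lambda>s s'. ph i s * z s))"

text \<open>X_n = O_p(r_n), phrased with outer probability (no measurability needed).\<close>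
definition bigOp :: "'w measure \<Rightarrow> (nat \<Rightarrow> 'w \<Rightarrow> real) \<Rightarrow> (nat \<Rightarrow> real) \<Rightarrow> bool" where
  "bigOp M X r \<longleftrightarrow> (\<forall>\<epsilon>>0. \<exists>B N. \<forall>n\<ge>N. \<exists>E\<in>sets M.
      {\<omega>\<in>space M. \<bar>X n \<omega>\<bar> > B * r n} \<subseteq> E \<and> measure M E < \<epsilon>)"

text \<open>Event P n holds with probability approaching one (inner probability).\<close>
definition wpa1 :: "'w measure \<Rightarrow> (nat \<Rightarrow> 'w \<Rightarrow> bool) \<Rightarrow> bool" where
  "wpa1 M P \<longleftrightarrow> (\<forall>\<epsilon>>0. \<exists>N. \<forall>n\<ge>N. \<exists>E\<in>sets M.
      E \<subseteq> {\<omega>\<in>space M. P n \<omega>} \<and> measure M E > 1 - \<epsilon>)"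

end

(* Write q(w) = E[(phi^T w)^2] and let Kf = E[f(s') | s], a contraction of L^2(mu) by stationarity.
   The matrix B = E[phi (phi - beta phi')^T] satisfies w^T B w >= (1 - beta) q(w) >= (1 - beta) c |w|^2,
   so it is coercive.  For e = h - phi^T omega* and d = phi^T omega* - P_phi h one has
   |e|^2 = |h - P_phi h|^2 + |d|^2 and, because omega* solves the projected fixed point equation,
   |d|^2 = -beta <d, K e>; this gives (ii).  The Frobenius distance of the empirical matrix from B
   has mean square O(k^2/n), so the empirical matrix inherits coercivity with probability tending
   to one, and its product with omega-hat - omega* is the empirical mean of phi u, where the
   temporal difference residual u = z - phi^T omega* + beta phi'^T omega* has a second moment
   bounded in n and E[phi u] = 0.  Hence its mean square is O(k/n).  Finally q(w) <= k Mb^2 |w|^2. *)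

theory Submission
  imports Defs
begin

text \<open>The dimension \<open>k\<close> varies with n, so all estimates are made at a fixed n
  with constants explicit in \<open>k\<close>; limits are taken only in the last theorem. Three
  choices keep the rates as small as claimed. The coefficient error is read off one linear equation
  in which the matrix noise stays on the left. The noise on the right is centred exactly, although
  the sieve solution is not h and the residual u need not be centred given s. Its size is measured
  by second moments: the supremum of the sieve solution may grow with \<open>k\<close>, but an
  energy estimate bounds its L^2 norm by L / (1 - beta). The matrix noise is measured in the
  Frobenius norm; its k^2 entries of variance O(1/n) are where the condition k^2/n -> 0 enters.
  Transitions of one individual are dependent, so independence is used across individuals only;
  inside a trajectory Cauchy-Schwarz costs a factor that the normalisation cancels. The hypothesis
  on the basis speaks of eigenvalues while every estimate needs a quadratic form, hence the
  variational argument for the least eigenvalue.\<close>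

subsection \<open>Coercive matrices\<close>

text \<open>First variation of a quadratic form along the line v + t x: symmetry of \<open>G\<close>
  merges the two cross terms into one linear term in t.\<close>

lemma sum_bilinear_expand:
  fixes G :: "nat \<Rightarrow> nat \<Rightarrow> real"
  assumes sym: "\<And>i j. i < k \<Longrightarrow> j < k \<Longrightarrow> G i j = G j i"
  shows "(\<Sum>i<k. \<Sum>j<k. (v i + t * x i) * G i j * (v j + t * x j)) =
    (\<Sum>i<k. \<Sum>j<k. v i * G i j * v j) + 2 * t * (\<Sum>i<k. x i * (\<Sum>j<k. G i j * v j))
    + t\<^sup>2 * (\<Sum>i<k. \<Sum>j<k. x i * G i j * x j)"
proof -
  have "(\<Sum>i<k. \<Sum>j<k. v i * G i j * x j) = (\<Sum>j<k. \<Sum>i<k. v i * G i j * x j)"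
    by (rule sum.swap)
  also have "\<dots> = (\<Sum>i<k. \<Sum>j<k. x i * G i j * v j)"
    by (intro sum.cong refl) (simp add: sym)
  finally have swap: "(\<Sum>i<k. \<Sum>j<k. v i * G i j * x j) = (\<Sum>i<k. \<Sum>j<k. x i * G i j * v j)" .
  have "(\<Sum>i<k. \<Sum>j<k. (v i + t * x i) * G i j * (v j + t * x j)) =
    (\<Sum>i<k. \<Sum>j<k. v i * G i j * v j) + t * (\<Sum>i<k. \<Sum>j<k. v i * G i j * x j)
    + t * (\<Sum>i<k. \<Sum>j<k. x i * G i j * v j) + t\<^sup>2 * (\<Sum>i<k. \<Sum>j<k. x i * G i j * x j)"
    by (simp add: sum_distrib_left sum.distrib[symmetric] algebra_simps power2_eq_square)
  also have "(\<Sum>i<k. \<Sum>j<k. x i * G i j * v j) = (\<Sum>i<k. x i * (\<Sum>j<k. G i j * v j))"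
    by (simp add: sum_distrib_left mult.assoc)
  also have "(\<Sum>i<k. \<Sum>j<k. v i * G i j * x j) = (\<Sum>i<k. x i * (\<Sum>j<k. G i j * v j))"
    using swap by (simp add: sum_distrib_left mult.assoc)
  finally show ?thesis by simp
qed

lemma linear_coeff_zero_if_quadratic_nonneg:
  fixes a b :: real
  assumes "\<And>t. 0 \<le> a * t + b * t\<^sup>2"
  shows "a = 0"
proof (rule ccontr)
  assume "a \<noteq> 0"
  \<comment> \<open>Any positive s above b works: at t = -a/s the polynomial equals a^2 (b - s) /
    s^2, which is negative.\<close>
  define s where "s = \<bar>b\<bar> + 1"
  have s: "s > 0" "b < s" by (auto simp: s_def)
  have "0 \<le> a * (- a / s) + b * (- a / s)\<^sup>2" by (rule assms)
  also have "\<dots> = a\<^sup>2 * (b - s) / s\<^sup>2"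
    using s by (simp add: field_simps power2_eq_square)
  also have "\<dots> < 0"
    using s \<open>a \<noteq> 0\<close> by (intro divide_neg_pos mult_pos_neg) auto
  finally show False by simp
qed

lemma index_mult_mat_vec_lessThan:
  assumes "A \<in> carrier_mat k k" "v \<in> carrier_vec k" "i < k"
  shows "(A *\<^sub>v v) $ i = (\<Sum>j<k. A $$ (i,j) * v $ j)"
  using assms by (simp add: scalar_prod_def lessThan_atLeast0)

text \<open>Vectors of variable dimension are encoded as functions that vanish from \<open>k\<close>
  on, so the product topology applies: the sphere is a closed subset of a box that is compact by
  Tychonoff.\<close>

lemma compact_unit_sphere_nat:
  "compact {w :: nat \<Rightarrow> real. (\<forall>i\<ge>k. w i = 0) \<and> (\<Sum>i<k. (w i)\<^sup>2) = 1}"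
proof -
  let ?T = "\<lambda>i. if i < k then {-1..1::real} else {0}"
  have "compactin (product_topology (\<lambda>_. euclidean) UNIV) (PiE UNIV ?T)"
    by (subst compactin_PiE) auto
  then have T: "compact (PiE UNIV ?T)"
    by (simp add: euclidean_product_topology)
  have "continuous_on UNIV (\<lambda>w::nat \<Rightarrow> real. \<Sum>i<k. (w i)\<^sup>2)"
    by (intro continuous_intros) (rule continuous_on_product_coordinates)
  then have "closed {w :: nat \<Rightarrow> real. (\<Sum>i<k. (w i)\<^sup>2) = 1}"
    by (intro closed_Collect_eq) auto
  then have "compact (PiE UNIV ?T \<inter> {w. (\<Sum>i<k. (w i)\<^sup>2) = 1})"
    using T by (rule compact_Int_closed[rotated])
  moreover have "{w :: nat \<Rightarrow> real. (\<forall>i\<ge>k. w i = 0) \<and> (\<Sum>i<k. (w i)\<^sup>2) = 1}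
      = PiE UNIV ?T \<inter> {w. (\<Sum>i<k. (w i)\<^sup>2) = 1}"
  proof -
    have "\<bar>w i\<bar> \<le> 1" if "(\<Sum>i<k. (w i)\<^sup>2) = 1" "i < k" for w :: "nat \<Rightarrow> real" and i
    proof -
      have "(w i)\<^sup>2 \<le> (\<Sum>i<k. (w i)\<^sup>2)"
        using that(2) by (intro member_le_sum) auto
      then show ?thesis using that(1) by (simp add: abs_square_le_1)
    qed
    then show ?thesis
      by (fastforce simp: PiE_iff abs_le_iff not_less minus_le_iff split: if_splits)
  qed
  ultimately show ?thesis by simp
qed

text \<open>The minimum of the Rayleigh quotient over the unit sphere is attained at an eigenvector.\<close>

lemma quadratic_form_ge_least_eigenvalue:
  fixes G :: "real mat"
  assumes G: "G \<in> carrier_mat k k"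
    and sym: "\<And>i j. i < k \<Longrightarrow> j < k \<Longrightarrow> G $$ (i,j) = G $$ (j,i)"
    and ev: "\<And>e. eigenvalue G e \<Longrightarrow> c \<le> e"
  shows "c * (\<Sum>i<k. (w i)\<^sup>2) \<le> (\<Sum>i<k. \<Sum>j<k. w i * G $$ (i,j) * w j)"
proof (cases "(\<Sum>i<k. (w i)\<^sup>2) = 0")
  case True
  then have "w i = 0" if "i < k" for i
    using that by (subst (asm) sum_nonneg_eq_0_iff) auto
  then show ?thesis using True by simp
next
  case False
  define S where "S = {w :: nat \<Rightarrow> real. (\<forall>i\<ge>k. w i = 0) \<and> (\<Sum>i<k. (w i)\<^sup>2) = 1}"
  define q where "q = (\<lambda>w. \<Sum>i<k. \<Sum>j<k. w i * G $$ (i,j) * w j)"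
  have qc: "q (\<lambda>i. a * u i) = a\<^sup>2 * q u" for a u
    by (simp add: q_def sum_distrib_left power2_eq_square mult_ac)
  \<comment> \<open>Coordinates from \<open>k\<close> on are cut off because membership in
    \<open>S\<close> asks for it; \<open>q\<close> does not see them.\<close>
  define normalize :: "(nat \<Rightarrow> real) \<Rightarrow> nat \<Rightarrow> real" where
    "normalize = (\<lambda>u i. if i < k then 1 / sqrt (\<Sum>i<k. (u i)\<^sup>2) * u i else 0)"
  have nS: "normalize u \<in> S" and nq: "q (normalize u) = q u / (\<Sum>i<k. (u i)\<^sup>2)"
    if "(\<Sum>i<k. (u i)\<^sup>2) \<noteq> 0" for u
  proof -
    have pos: "(\<Sum>i<k. (u i)\<^sup>2) > 0"
      using that by (metis sum_nonneg zero_le_power2 order_le_less)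
    have "(\<Sum>i<k. (normalize u i)\<^sup>2) = (\<Sum>i<k. (u i)\<^sup>2 / (\<Sum>i<k. (u i)\<^sup>2))"
      using pos by (intro sum.cong) (auto simp: normalize_def power_divide)
    also have "\<dots> = 1" using pos by (simp flip: sum_divide_distrib)
    finally show "normalize u \<in> S" by (auto simp: S_def normalize_def)
    have "q (normalize u) = q (\<lambda>i. 1 / sqrt (\<Sum>i<k. (u i)\<^sup>2) * u i)"
      unfolding q_def by (intro sum.cong) (auto simp: normalize_def)
    then show "q (normalize u) = q u / (\<Sum>i<k. (u i)\<^sup>2)"
      using pos by (simp only: qc) (simp add: power_divide)
  qed
  have "compact S" unfolding S_def by (rule compact_unit_sphere_nat)
  moreover have "S \<noteq> {}" using nS[OF False] by auto
  moreover have "continuous_on S q"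
    unfolding q_def
    by (intro continuous_intros continuous_on_subset[OF continuous_on_product_coordinates]) auto
  ultimately obtain v where v: "v \<in> S" "\<And>u. u \<in> S \<Longrightarrow> q v \<le> q u"
    using continuous_attains_inf by metis
  define e where "e = q v"
  have lower: "e * (\<Sum>i<k. (u i)\<^sup>2) \<le> q u" for u
  proof (cases "(\<Sum>i<k. (u i)\<^sup>2) = 0")
    case True
    then have "u i = 0" if "i < k" for i
      using that by (subst (asm) sum_nonneg_eq_0_iff) auto
    then show ?thesis using True by (simp add: q_def)
  next
    case False
    then have "(\<Sum>i<k. (u i)\<^sup>2) > 0"
      by (metis sum_nonneg zero_le_power2 order_le_less)
    then show ?thesis
      using v(2)[OF nS[OF False]] nq[OF False] by (simp add: e_def field_simps)
  qed
  have vn: "(\<Sum>i<k. (v i)\<^sup>2) = 1" using v(1) by (simp add: S_def)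
  \<comment> \<open>The eigenvector residual of the minimiser \<open>v\<close> is also the direction
    in which \<open>v\<close> is perturbed: the coefficient of t is then twice the squared norm of
    the residual, and minimality makes it vanish.\<close>
  define x where "x = (\<lambda>i. (\<Sum>j<k. G $$ (i,j) * v j) - e * v i)"
  have "2 * (\<Sum>i<k. (x i)\<^sup>2) = 0"
  proof (rule linear_coeff_zero_if_quadratic_nonneg)
    fix t :: real
    have "0 \<le> q (\<lambda>i. v i + t * x i) - e * (\<Sum>i<k. (v i + t * x i)\<^sup>2)"
      using lower[of "\<lambda>i. v i + t * x i"] by simp
    also have "q (\<lambda>i. v i + t * x i) =
        e + 2 * t * (\<Sum>i<k. x i * (\<Sum>j<k. G $$ (i,j) * v j)) + t\<^sup>2 * q x"
      unfolding q_def e_def using sum_bilinear_expand[of k "\<lambda>i j. G $$ (i,j)" v t x] sym by simp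
    also have "(\<Sum>i<k. (v i + t * x i)\<^sup>2) = (\<Sum>i<k. (v i)\<^sup>2) + 2 * t * (\<Sum>i<k. x i * v i) + t\<^sup>2 * (\<Sum>i<k. (x i)\<^sup>2)"
      by (simp add: sum_distrib_left sum.distrib[symmetric] algebra_simps power2_eq_square)
    also have "e + 2 * t * (\<Sum>i<k. x i * (\<Sum>j<k. G $$ (i,j) * v j)) + t\<^sup>2 * q x
        - e * ((\<Sum>i<k. (v i)\<^sup>2) + 2 * t * (\<Sum>i<k. x i * v i) + t\<^sup>2 * (\<Sum>i<k. (x i)\<^sup>2))
        = 2 * t * ((\<Sum>i<k. x i * (\<Sum>j<k. G $$ (i,j) * v j)) - e * (\<Sum>i<k. x i * v i))
          + t\<^sup>2 * (q x - e * (\<Sum>i<k. (x i)\<^sup>2))"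
      using vn by (simp add: algebra_simps)
    also have "(\<Sum>i<k. x i * (\<Sum>j<k. G $$ (i,j) * v j)) - e * (\<Sum>i<k. x i * v i) = (\<Sum>i<k. (x i)\<^sup>2)"
      unfolding sum_distrib_left[of e] sum_subtractf[symmetric]
      by (intro sum.cong refl) (simp add: x_def power2_eq_square algebra_simps)
    finally show "0 \<le> 2 * (\<Sum>i<k. (x i)\<^sup>2) * t + (q x - e * (\<Sum>i<k. (x i)\<^sup>2)) * t\<^sup>2"
      by (simp add: mult_ac)
  qed
  then have x0: "x i = 0" if "i < k" for i
    using that by (auto simp: sum_nonneg_eq_0_iff)
  have "eigenvector G (vec k v) e"
    unfolding eigenvector_def
  proof (intro conjI)
    show "vec k v \<in> carrier_vec (dim_row G)" using G by simp
    show "vec k v \<noteq> 0\<^sub>v (dim_row G)"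
    proof
      assume "vec k v = 0\<^sub>v (dim_row G)"
      then have "v i = 0" if "i < k" for i
        using that G by (metis carrier_matD(1) index_vec index_zero_vec(1))
      then show False using vn by simp
    qed
    show "G *\<^sub>v vec k v = e \<cdot>\<^sub>v vec k v"
    proof (rule eq_vecI)
      fix i assume "i < dim_vec (e \<cdot>\<^sub>v vec k v)"
      then have i: "i < k" by simp
      then have "(G *\<^sub>v vec k v) $ i = (\<Sum>j<k. G $$ (i,j) * v j)"
        using G by (subst index_mult_mat_vec_lessThan[of _ k]) auto
      then show "(G *\<^sub>v vec k v) $ i = (e \<cdot>\<^sub>v vec k v) $ i"
        using x0[OF i] i by (simp add: x_def)
    qed (use G in simp)
  qed
  then have "c \<le> e" using ev unfolding eigenvalue_def by blast
  then have "c * (\<Sum>i<k. (w i)\<^sup>2) \<le> e * (\<Sum>i<k. (w i)\<^sup>2)"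
    by (intro mult_right_mono sum_nonneg) auto
  also have "\<dots> \<le> q w" by (rule lower)
  finally show ?thesis by (simp add: q_def)
qed

section \<open>Invertibility, stability and perturbation of coercive matrices\<close>

lemma invertible_mat_if_injective:
  fixes A :: "real mat"
  assumes A: "A \<in> carrier_mat k k"
    and inj: "\<And>v. v \<in> carrier_vec k \<Longrightarrow> A *\<^sub>v v = 0\<^sub>v k \<Longrightarrow> v = 0\<^sub>v k"
  shows "invertible_mat A"
proof -
  have "det A \<noteq> 0"
    using det_0_iff_vec_prod_zero_field[OF A] inj by auto
  from det_non_zero_imp_unit[OF A this, of "()"]
  obtain B where "B \<in> carrier_mat k k" "A * B = 1\<^sub>m k" "B * A = 1\<^sub>m k"
    unfolding Units_def by (auto simp: ring_mat_def)
  then show ?thesis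
    using A unfolding invertible_mat_def inverts_mat_def by (auto simp: square_mat.simps)
qed

lemma minv_inverts:
  assumes A: "A \<in> carrier_mat k k" and inv: "invertible_mat A"
  shows "minv A \<in> carrier_mat k k" "A * minv A = 1\<^sub>m k"
proof -
  have "\<exists>B. inverts_mat A B \<and> inverts_mat B A"
    using inv by (auto simp: invertible_mat_def)
  then have "inverts_mat A (minv A) \<and> inverts_mat (minv A) A"
    unfolding minv_def using inv by (simp add: someI_ex[of "\<lambda>B. inverts_mat A B \<and> inverts_mat B A"])
  then have 1: "A * minv A = 1\<^sub>m k" and 2: "minv A * A = 1\<^sub>m (dim_row (minv A))"
    using A by (auto simp: inverts_mat_def)
  \<comment> \<open>\<open>inverts_mat\<close> puts no condition on the shape of the inverse, so its
    dimensions are read off the two products.\<close>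
  have "dim_col (minv A) = k"
    using arg_cong[OF 1, of dim_col] by simp
  moreover have "dim_row (minv A) = k"
    using arg_cong[OF 2, of dim_col] A by simp
  ultimately show "minv A \<in> carrier_mat k k" by auto
  show "A * minv A = 1\<^sub>m k" by (rule 1)
qed

lemma minv_solves:
  assumes A: "A \<in> carrier_mat k k" and inv: "invertible_mat A" and b: "b \<in> carrier_vec k"
  shows "minv A *\<^sub>v b \<in> carrier_vec k" "A *\<^sub>v (minv A *\<^sub>v b) = b"
proof -
  note minv = minv_inverts[OF A inv]
  show "minv A *\<^sub>v b \<in> carrier_vec k" using minv(1) b by simp
  have "A *\<^sub>v (minv A *\<^sub>v b) = (A * minv A) *\<^sub>v b"
    using A minv(1) b by simp
  then show "A *\<^sub>v (minv A *\<^sub>v b) = b" using minv(2) b by simp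
qed

lemma coercive_invertible_mat:
  fixes A :: "real mat"
  assumes A: "A \<in> carrier_mat k k" and c: "c > 0"
    and coercive: "\<And>w. c * (\<Sum>i<k. (w i)\<^sup>2) \<le> (\<Sum>i<k. \<Sum>j<k. w i * A $$ (i,j) * w j)"
  shows "invertible_mat A"
proof (rule invertible_mat_if_injective[OF A])
  fix v assume v: "v \<in> carrier_vec k" and Av: "A *\<^sub>v v = 0\<^sub>v k"
  have "(\<Sum>j<k. A $$ (i,j) * v $ j) = 0" if "i < k" for i
    using index_mult_mat_vec_lessThan[OF A v that] Av that by simp
  then have "(\<Sum>i<k. \<Sum>j<k. v $ i * A $$ (i,j) * v $ j) = 0"
    by (simp add: mult.assoc flip: sum_distrib_left)
  then have "c * (\<Sum>i<k. (v $ i)\<^sup>2) \<le> 0" using coercive[of "\<lambda>i. v $ i"] by simp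
  then have "(\<Sum>i<k. (v $ i)\<^sup>2) \<le> 0" using c by (simp add: mult_le_0_iff)
  then have "(\<Sum>i<k. (v $ i)\<^sup>2) = 0" by (simp add: order_antisym sum_nonneg)
  then have "v $ i = 0" if "i < k" for i using that by (auto simp: sum_nonneg_eq_0_iff)
  then show "v = 0\<^sub>v k" using v by (intro eq_vecI) auto
qed

text \<open>The finite-dimensional Lax-Milgram bound: Cauchy-Schwarz on the coercivity inequality,
  then cancellation of |v|. It turns a bound on the residual of a linear system into a bound on the
  error of its solution.\<close>

lemma coercive_eucl_norm_le:
  fixes A :: "real mat"
  assumes A: "A \<in> carrier_mat k k" and c: "c > 0" and v: "v \<in> carrier_vec k"
    and coercive: "\<And>w. c * (\<Sum>i<k. (w i)\<^sup>2) \<le> (\<Sum>i<k. \<Sum>j<k. w i * A $$ (i,j) * w j)"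
  shows "eucl_norm v \<le> eucl_norm (A *\<^sub>v v) / c"
proof -
  have n: "eucl_norm u = L2_set (\<lambda>i. u $ i) {..<k}" if "u \<in> carrier_vec k" for u
    using that by (auto simp: eucl_norm_def L2_set_def)
  have Av: "A *\<^sub>v v \<in> carrier_vec k" using A v by simp
  have "c * (eucl_norm v)\<^sup>2 = c * (\<Sum>i<k. (v $ i)\<^sup>2)"
    using v by (simp add: eucl_norm_def sum_nonneg)
  also have "\<dots> \<le> (\<Sum>i<k. v $ i * (A *\<^sub>v v) $ i)"
    using coercive[of "\<lambda>i. v $ i"]
    by (simp add: index_mult_mat_vec_lessThan[OF A v] sum_distrib_left mult.assoc
          del: index_mult_mat_vec)
  also have "\<dots> \<le> (\<Sum>i<k. \<bar>v $ i\<bar> * \<bar>(A *\<^sub>v v) $ i\<bar>)"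
    by (intro sum_mono) (simp flip: abs_mult)
  also have "\<dots> \<le> eucl_norm v * eucl_norm (A *\<^sub>v v)"
    using L2_set_mult_ineq by (simp only: n[OF v] n[OF Av])
  finally have "eucl_norm v * (c * eucl_norm v) \<le> eucl_norm v * eucl_norm (A *\<^sub>v v)"
    by (simp add: power2_eq_square mult_ac)
  then have "c * eucl_norm v \<le> eucl_norm (A *\<^sub>v v) \<or> eucl_norm v = 0"
    by (smt (verit) eucl_norm_def mult_le_cancel_left_pos real_sqrt_ge_zero sum_nonneg zero_le_power2)
  then show ?thesis
  proof
    assume "c * eucl_norm v \<le> eucl_norm (A *\<^sub>v v)"
    then show ?thesis using c by (simp add: field_simps)
  next
    assume "eucl_norm v = 0"
    then show ?thesis using c by (simp add: eucl_norm_def sum_nonneg)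
  qed
qed

text \<open>Cauchy-Schwarz over index pairs: the family of products w_i w_j has Euclidean norm
  |w|^2.\<close>

lemma abs_sum_products_le_frobenius:
  fixes D :: "nat \<Rightarrow> nat \<Rightarrow> real"
  shows "\<bar>\<Sum>i<k. \<Sum>j<k. w i * D i j * w j\<bar> \<le> sqrt (\<Sum>i<k. \<Sum>j<k. (D i j)\<^sup>2) * (\<Sum>i<k. (w i)\<^sup>2)"
proof -
  let ?I = "{..<k} \<times> {..<k}"
  have "\<bar>\<Sum>i<k. \<Sum>j<k. w i * D i j * w j\<bar> = \<bar>\<Sum>p\<in>?I. D (fst p) (snd p) * (w (fst p) * w (snd p))\<bar>"
    by (simp add: sum.cartesian_product case_prod_beta mult_ac)
  also have "\<dots> \<le> (\<Sum>p\<in>?I. \<bar>D (fst p) (snd p)\<bar> * \<bar>w (fst p) * w (snd p)\<bar>)"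
    by (rule order.trans[OF sum_abs]) (simp add: abs_mult)
  also have "\<dots> \<le> L2_set (\<lambda>p. D (fst p) (snd p)) ?I * L2_set (\<lambda>p. w (fst p) * w (snd p)) ?I"
    by (rule L2_set_mult_ineq)
  also have "L2_set (\<lambda>p. D (fst p) (snd p)) ?I = sqrt (\<Sum>i<k. \<Sum>j<k. (D i j)\<^sup>2)"
    by (simp add: L2_set_def sum.cartesian_product case_prod_beta)
  also have "L2_set (\<lambda>p. w (fst p) * w (snd p)) ?I = sqrt ((\<Sum>i<k. (w i)\<^sup>2) * (\<Sum>i<k. (w i)\<^sup>2))"
    by (simp add: L2_set_def sum.cartesian_product sum_product case_prod_beta power_mult_distrib)
  finally show ?thesis by (simp add: sum_nonneg)
qed

text \<open>The Frobenius norm dominates the quadratic form, and its square is a sum over entries,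
  so for a random \<open>B\<close> its expectation can be computed entry by entry.\<close>

lemma coercive_perturb:
  fixes A B :: "nat \<Rightarrow> nat \<Rightarrow> real"
  assumes coercive: "\<And>w. c * (\<Sum>i<k. (w i)\<^sup>2) \<le> (\<Sum>i<k. \<Sum>j<k. w i * A i j * w j)"
    and D: "(\<Sum>i<k. \<Sum>j<k. (B i j - A i j)\<^sup>2) \<le> \<delta>\<^sup>2" and \<delta>: "0 \<le> \<delta>"
  shows "(c - \<delta>) * (\<Sum>i<k. (w i)\<^sup>2) \<le> (\<Sum>i<k. \<Sum>j<k. w i * B i j * w j)"
proof -
  have "sqrt (\<Sum>i<k. \<Sum>j<k. (B i j - A i j)\<^sup>2) \<le> \<delta>"
    using D \<delta> by (simp add: real_le_lsqrt sum_nonneg)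
  then have "sqrt (\<Sum>i<k. \<Sum>j<k. (B i j - A i j)\<^sup>2) * (\<Sum>i<k. (w i)\<^sup>2) \<le> \<delta> * (\<Sum>i<k. (w i)\<^sup>2)"
    by (intro mult_right_mono sum_nonneg) auto
  then have "\<bar>\<Sum>i<k. \<Sum>j<k. w i * (B i j - A i j) * w j\<bar> \<le> \<delta> * (\<Sum>i<k. (w i)\<^sup>2)"
    using abs_sum_products_le_frobenius[of w "\<lambda>i j. B i j - A i j" k] by linarith
  moreover have "(\<Sum>i<k. \<Sum>j<k. w i * (B i j - A i j) * w j) =
      (\<Sum>i<k. \<Sum>j<k. w i * B i j * w j) - (\<Sum>i<k. \<Sum>j<k. w i * A i j * w j)"
    by (simp add: algebra_simps sum_subtractf)
  ultimately show ?thesis using coercive[of w] by (simp add: algebra_simps abs_le_iff)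
qed

subsection \<open>Stationary Markov kernels\<close>

lemma integrable_mult_if_square_integrable:
  fixes f g :: "'s \<Rightarrow> real"
  assumes [measurable]: "f \<in> borel_measurable M" "g \<in> borel_measurable M"
    and "integrable M (\<lambda>s. (f s)\<^sup>2)" "integrable M (\<lambda>s. (g s)\<^sup>2)"
  shows "integrable M (\<lambda>s. f s * g s)"
proof (rule Bochner_Integration.integrable_bound)
  show "integrable M (\<lambda>s. (f s)\<^sup>2 + (g s)\<^sup>2)" using assms by simp
  have "\<bar>f s * g s\<bar> \<le> (f s)\<^sup>2 + (g s)\<^sup>2" for s
  proof -
    have "0 \<le> \<bar>f s\<bar> * \<bar>g s\<bar>" by simp
    then show ?thesis
      using sum_squares_bound[of "\<bar>f s\<bar>" "\<bar>g s\<bar>"] by (simp only: abs_mult power2_abs mult.assoc)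
  qed
  then show "AE s in M. norm (f s * g s) \<le> norm ((f s)\<^sup>2 + (g s)\<^sup>2)" by simp
qed simp

lemma square_integrable_diff:
  fixes f g :: "'s \<Rightarrow> real"
  assumes [measurable]: "f \<in> borel_measurable M" "g \<in> borel_measurable M"
    and "integrable M (\<lambda>s. (f s)\<^sup>2)" "integrable M (\<lambda>s. (g s)\<^sup>2)"
  shows "integrable M (\<lambda>s. (f s - g s)\<^sup>2)"
  using integrable_mult_if_square_integrable[OF assms] assms(3,4)
  by (simp add: power2_diff mult.assoc)

lemma (in prob_space) integrable_if_square_integrable:
  fixes f :: "'a \<Rightarrow> real"
  assumes "f \<in> borel_measurable M" "integrable M (\<lambda>s. (f s)\<^sup>2)"
  shows "integrable M f"
  using integrable_mult_if_square_integrable[of f M "\<lambda>_. 1"] assms by simp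

lemma (in prob_space) square_expectation_le:
  fixes f :: "'a \<Rightarrow> real"
  assumes "f \<in> borel_measurable M" "integrable M (\<lambda>s. (f s)\<^sup>2)"
  shows "(expectation f)\<^sup>2 \<le> expectation (\<lambda>s. (f s)\<^sup>2)"
  using variance_eq[OF integrable_if_square_integrable[OF assms] assms(2)]
    variance_positive[of f] by simp

section \<open>The kernel as a contraction of L^2\<close>

locale stationary_kernel = prob_space \<mu> for \<mu> :: "'s measure" +
  fixes K :: "'s \<Rightarrow> 's measure"
  assumes K_prob [measurable]: "K \<in> \<mu> \<rightarrow>\<^sub>M prob_algebra \<mu>"
    and stationary: "\<And>A. A \<in> sets \<mu> \<Longrightarrow> measure \<mu> A = (\<integral>s. measure (K s) A \<partial>\<mu>)"
begin

lemma K_subprob [measurable]: "K \<in> \<mu> \<rightarrow>\<^sub>M subprob_algebra \<mu>"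
  using K_prob by (rule measurable_prob_algebraD)

lemma
  assumes "s \<in> space \<mu>"
  shows prob_space_K: "prob_space (K s)"
    and sets_K: "sets (K s) = sets \<mu>"
    and space_K: "space (K s) = space \<mu>"
proof -
  have "K s \<in> space (prob_algebra \<mu>)" using measurable_space[OF K_prob assms] .
  then show "prob_space (K s)" and s: "sets (K s) = sets \<mu>" by (auto simp: space_prob_algebra)
  from sets_eq_imp_space_eq[OF s] show "space (K s) = space \<mu>" .
qed

lemma measurable_K: "s \<in> space \<mu> \<Longrightarrow> f \<in> borel_measurable \<mu> \<Longrightarrow> f \<in> borel_measurable (K s)"
  using sets_K by (simp cong: measurable_cong_sets)

lemma self_prob_algebra: "\<mu> \<in> space (prob_algebra \<mu>)"
  by (simp add: space_prob_algebra prob_space_axioms)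

text \<open>Stationarity is assumed on sets; as an identity of measures it passes to integrals
  through the bind formulas.\<close>

lemma bind_K: "\<mu> \<bind> K = \<mu>"
proof (rule measure_eqI)
  show sets: "sets (\<mu> \<bind> K) = sets \<mu>"
    by (rule sets_bind'[OF self_prob_algebra K_prob])
  fix A assume "A \<in> sets (\<mu> \<bind> K)"
  then have A: "A \<in> sets \<mu>" by (simp add: sets)
  have "emeasure (\<mu> \<bind> K) A = (\<integral>\<^sup>+s. emeasure (K s) A \<partial>\<mu>)"
    by (rule emeasure_bind_prob_algebra[OF self_prob_algebra K_prob A])
  also have "\<dots> = (\<integral>\<^sup>+s. ennreal (measure (K s) A) \<partial>\<mu>)"
  proof (rule nn_integral_cong)
    fix s assume "s \<in> space \<mu>"
    then interpret K: prob_space "K s" by (rule prob_space_K)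
    show "emeasure (K s) A = ennreal (measure (K s) A)" by (rule K.emeasure_eq_measure)
  qed
  also have "\<dots> = ennreal (\<integral>s. measure (K s) A \<partial>\<mu>)"
  proof (rule nn_integral_eq_integral)
    have "(\<lambda>s. measure (K s) A) \<in> borel_measurable \<mu>"
      using A by measurable
    then show "integrable \<mu> (\<lambda>s. measure (K s) A)"
      by (intro integrable_const_bound[of _ 1]) (auto simp: prob_space_K prob_space.prob_le_1)
  qed simp
  finally show "emeasure (\<mu> \<bind> K) A = emeasure \<mu> A"
    by (simp add: emeasure_eq_measure stationary[OF A])
qed

lemma nn_integral_K:
  assumes "f \<in> borel_measurable \<mu>"
  shows "(\<integral>\<^sup>+s. \<integral>\<^sup>+s'. f s' \<partial>K s \<partial>\<mu>) = (\<integral>\<^sup>+s. f s \<partial>\<mu>)"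
  using nn_integral_bind[OF assms K_subprob] by (simp add: bind_K)

lemma measurable_integral_K [measurable]:
  fixes f :: "'s \<Rightarrow> real"
  assumes "f \<in> borel_measurable \<mu>"
  shows "(\<lambda>s. \<integral>s'. f s' \<partial>K s) \<in> borel_measurable \<mu>"
  using measurable_compose[OF K_subprob integral_measurable_subprob_algebra[OF assms]] .

lemma abs_integral_K_le:
  fixes f :: "'s \<Rightarrow> real"
  assumes s: "s \<in> space \<mu>" and f: "f \<in> borel_measurable \<mu>" "\<And>s. s \<in> space \<mu> \<Longrightarrow> \<bar>f s\<bar> \<le> b"
  shows "\<bar>\<integral>s'. f s' \<partial>K s\<bar> \<le> b"
proof -
  interpret K: prob_space "K s" using s by (rule prob_space_K)
  have int: "integrable (K s) f"
    using f measurable_K[OF s f(1)] by (intro K.integrable_const_bound[of _ b]) (auto simp: space_K[OF s])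
  have "\<bar>\<integral>s'. f s' \<partial>K s\<bar> \<le> (\<integral>s'. \<bar>f s'\<bar> \<partial>K s)"
    using integral_norm_bound[of "K s" f] by simp
  also have "\<dots> \<le> b"
    using int f(2) by (intro K.integral_le_const) (auto simp: space_K[OF s])
  finally show ?thesis .
qed

lemma integral_K_bounded:
  fixes f :: "'s \<Rightarrow> real"
  assumes f: "f \<in> borel_measurable \<mu>" "\<And>s. s \<in> space \<mu> \<Longrightarrow> \<bar>f s\<bar> \<le> b"
  shows "(\<integral>s. \<integral>s'. f s' \<partial>K s \<partial>\<mu>) = (\<integral>s. f s \<partial>\<mu>)"
proof -
  have "AE s in \<mu>. emeasure (K s) (space (K s)) \<le> ennreal 1"
    by (auto simp: prob_space.emeasure_space_1 prob_space_K)
  from integral_bind[OF f K_subprob finite_measure_axioms this] show ?thesis by (simp add: bind_K)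
qed

text \<open>Jensen for each single \<open>s\<close>. A function that is square integrable under
  \<open>\<mu>\<close> may have infinite second moment under some \<open>K s\<close>; with a
  nonnegative integral on the right that case is trivial.\<close>

lemma square_integral_K_le_nn:
  fixes f :: "'s \<Rightarrow> real"
  assumes s: "s \<in> space \<mu>" and f: "f \<in> borel_measurable \<mu>"
  shows "ennreal ((\<integral>s'. f s' \<partial>K s)\<^sup>2) \<le> (\<integral>\<^sup>+s'. ennreal ((f s')\<^sup>2) \<partial>K s)"
proof (cases "(\<integral>\<^sup>+s'. ennreal ((f s')\<^sup>2) \<partial>K s) = \<infinity>")
  case False
  interpret K: prob_space "K s" using s by (rule prob_space_K)
  note [measurable] = measurable_K[OF s f]
  have int: "integrable (K s) (\<lambda>s. (f s)\<^sup>2)"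
    using False by (intro integrableI_nonneg) (auto simp: top.not_eq_extremum)
  have "ennreal ((\<integral>s'. f s' \<partial>K s)\<^sup>2) \<le> ennreal (\<integral>s'. (f s')\<^sup>2 \<partial>K s)"
    by (intro ennreal_leI K.square_expectation_le int) measurable
  also have "\<dots> = (\<integral>\<^sup>+s'. ennreal ((f s')\<^sup>2) \<partial>K s)"
    by (rule nn_integral_eq_integral[symmetric, OF int]) simp
  finally show ?thesis .
qed simp

text \<open>Jensen pointwise, then stationarity collapses the iterated integral. Working with
  nonnegative integrals lets one estimate yield both the integrability and the inequality.\<close>

lemma
  fixes f :: "'s \<Rightarrow> real"
  assumes f [measurable]: "f \<in> borel_measurable \<mu>" and f2: "integrable \<mu> (\<lambda>s. (f s)\<^sup>2)"
  shows square_integrable_integral_K: "integrable \<mu> (\<lambda>s. (\<integral>s'. f s' \<partial>K s)\<^sup>2)"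
    and integral_K_contraction: "(\<integral>s. (\<integral>s'. f s' \<partial>K s)\<^sup>2 \<partial>\<mu>) \<le> (\<integral>s. (f s)\<^sup>2 \<partial>\<mu>)"
proof -
  have "(\<integral>\<^sup>+s. ennreal ((\<integral>s'. f s' \<partial>K s)\<^sup>2) \<partial>\<mu>) \<le> (\<integral>\<^sup>+s. \<integral>\<^sup>+s'. ennreal ((f s')\<^sup>2) \<partial>K s \<partial>\<mu>)"
    by (intro nn_integral_mono square_integral_K_le_nn f)
  also have "\<dots> = (\<integral>\<^sup>+s. ennreal ((f s)\<^sup>2) \<partial>\<mu>)"
    by (rule nn_integral_K) measurable
  also have "\<dots> = ennreal (\<integral>s. (f s)\<^sup>2 \<partial>\<mu>)"
    by (rule nn_integral_eq_integral[OF f2]) simp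
  finally have le: "(\<integral>\<^sup>+s. ennreal ((\<integral>s'. f s' \<partial>K s)\<^sup>2) \<partial>\<mu>) \<le> ennreal (\<integral>s. (f s)\<^sup>2 \<partial>\<mu>)" .
  show int: "integrable \<mu> (\<lambda>s. (\<integral>s'. f s' \<partial>K s)\<^sup>2)"
    using le by (intro integrableI_nonneg) (auto intro: le_less_trans)
  show "(\<integral>s. (\<integral>s'. f s' \<partial>K s)\<^sup>2 \<partial>\<mu>) \<le> (\<integral>s. (f s)\<^sup>2 \<partial>\<mu>)"
    using le by (subst (asm) nn_integral_eq_integral[OF int]) auto
qed

text \<open>Needed for h, which is only square integrable: the iterated second moment is finite,
  hence finite at almost every \<open>s\<close>. This allows the kernel to be split over a
  difference that contains h.\<close>

lemma AE_integrable_K: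
  fixes f :: "'s \<Rightarrow> real"
  assumes f [measurable]: "f \<in> borel_measurable \<mu>" and f2: "integrable \<mu> (\<lambda>s. (f s)\<^sup>2)"
  shows "AE s in \<mu>. integrable (K s) f"
proof -
  have "(\<lambda>s. \<integral>\<^sup>+s'. ennreal ((f s')\<^sup>2) \<partial>K s) \<in> borel_measurable \<mu>"
    by (rule measurable_compose[OF K_subprob nn_integral_measurable_subprob_algebra]) measurable
  moreover have "(\<integral>\<^sup>+s. \<integral>\<^sup>+s'. ennreal ((f s')\<^sup>2) \<partial>K s \<partial>\<mu>) \<noteq> \<infinity>"
    by (subst nn_integral_K) (auto simp: nn_integral_eq_integral[OF f2])
  ultimately have "AE s in \<mu>. (\<integral>\<^sup>+s'. ennreal ((f s')\<^sup>2) \<partial>K s) \<noteq> \<infinity>"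
    by (rule nn_integral_PInf_AE)
  then show ?thesis
  proof (rule AE_mp, intro AE_I2 impI)
    fix s assume s: "s \<in> space \<mu>" and fin: "(\<integral>\<^sup>+s'. ennreal ((f s')\<^sup>2) \<partial>K s) \<noteq> \<infinity>"
    interpret K: prob_space "K s" using s by (rule prob_space_K)
    note [measurable] = measurable_K[OF s f]
    have "integrable (K s) (\<lambda>s. (f s)\<^sup>2)"
      using fin by (intro integrableI_nonneg) (auto simp: top.not_eq_extremum)
    then show "integrable (K s) f" by (rule K.integrable_if_square_integrable[rotated]) measurable
  qed
qed

text \<open>Makes the iterated integral \<open>Epair\<close> an expectation under one probability
  measure, so that monotonicity and the variance formula apply to it.\<close>

definition pair_law :: "('s \<times> 's) measure" where
  "pair_law = \<mu> \<bind> (\<lambda>s. distr (K s) (\<mu> \<Otimes>\<^sub>M \<mu>) (Pair s))"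

lemma pair_kernel: "(\<lambda>s. distr (K s) (\<mu> \<Otimes>\<^sub>M \<mu>) (Pair s)) \<in> \<mu> \<rightarrow>\<^sub>M prob_algebra (\<mu> \<Otimes>\<^sub>M \<mu>)"
  by (rule measurable_distr_prob_space2[OF K_prob]) simp

lemma sets_pair_law [simp, measurable_cong]: "sets pair_law = sets (\<mu> \<Otimes>\<^sub>M \<mu>)"
  unfolding pair_law_def by (rule sets_bind'[OF self_prob_algebra pair_kernel])

lemma space_pair_law [simp]: "space pair_law = space \<mu> \<times> space \<mu>"
  using sets_eq_imp_space_eq[OF sets_pair_law] by (simp add: space_pair_measure)

lemma prob_space_pair_law: "prob_space pair_law"
  unfolding pair_law_def by (rule prob_space_bind'[OF self_prob_algebra pair_kernel])

lemma measurable_Pair_K: "s \<in> space \<mu> \<Longrightarrow> Pair s \<in> K s \<rightarrow>\<^sub>M \<mu> \<Otimes>\<^sub>M \<mu>"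
  using sets_K by (simp cong: measurable_cong_sets)

lemma integral_pair_law:
  fixes f :: "'s \<times> 's \<Rightarrow> real"
  assumes f [measurable]: "f \<in> borel_measurable (\<mu> \<Otimes>\<^sub>M \<mu>)"
    and b: "\<And>p. p \<in> space \<mu> \<times> space \<mu> \<Longrightarrow> \<bar>f p\<bar> \<le> b"
  shows "(\<integral>p. f p \<partial>pair_law) = Epair \<mu> K (\<lambda>s s'. f (s, s'))"
proof -
  have "AE s in \<mu>. emeasure (distr (K s) (\<mu> \<Otimes>\<^sub>M \<mu>) (Pair s)) (space (distr (K s) (\<mu> \<Otimes>\<^sub>M \<mu>) (Pair s))) \<le> ennreal 1"
    using measurable_space[OF pair_kernel]
    by (auto simp: space_prob_algebra prob_space.emeasure_space_1 simp del: space_distr)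
  moreover have "\<bar>f p\<bar> \<le> b" if "p \<in> space (\<mu> \<Otimes>\<^sub>M \<mu>)" for p
    using b that by (simp add: space_pair_measure)
  ultimately
  have "(\<integral>p. f p \<partial>pair_law) = (\<integral>s. (\<integral>p. f p \<partial>distr (K s) (\<mu> \<Otimes>\<^sub>M \<mu>) (Pair s)) \<partial>\<mu>)"
    unfolding pair_law_def
    by (intro integral_bind[OF f _ measurable_prob_algebraD[OF pair_kernel] finite_measure_axioms])
  also have "\<dots> = Epair \<mu> K (\<lambda>s s'. f (s, s'))"
    unfolding Epair_def
    by (intro Bochner_Integration.integral_cong refl integral_distr measurable_Pair_K f)
  finally show ?thesis .
qed

lemma integrable_pair_law_bounded:
  fixes f :: "'s \<times> 's \<Rightarrow> real"
  assumes "f \<in> borel_measurable (\<mu> \<Otimes>\<^sub>M \<mu>)" "\<And>p. p \<in> space \<mu> \<times> space \<mu> \<Longrightarrow> \<bar>f p\<bar> \<le> b"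
  shows "integrable pair_law f"
proof -
  interpret P: prob_space pair_law by (rule prob_space_pair_law)
  show ?thesis using assms by (intro P.integrable_const_bound[of _ b]) (auto cong: measurable_cong_sets)
qed

lemma Epair_mono:
  assumes f: "case_prod f \<in> borel_measurable (\<mu> \<Otimes>\<^sub>M \<mu>)"
      "\<And>s s'. s \<in> space \<mu> \<Longrightarrow> s' \<in> space \<mu> \<Longrightarrow> \<bar>f s s'\<bar> \<le> a"
    and g: "case_prod g \<in> borel_measurable (\<mu> \<Otimes>\<^sub>M \<mu>)"
      "\<And>s s'. s \<in> space \<mu> \<Longrightarrow> s' \<in> space \<mu> \<Longrightarrow> \<bar>g s s'\<bar> \<le> b"
    and le: "\<And>s s'. s \<in> space \<mu> \<Longrightarrow> s' \<in> space \<mu> \<Longrightarrow> f s s' \<le> g s s'"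
  shows "Epair \<mu> K f \<le> Epair \<mu> K g"
proof -
  interpret P: prob_space pair_law by (rule prob_space_pair_law)
  have "P.expectation (case_prod f) \<le> P.expectation (case_prod g)"
  proof (rule integral_mono)
    show "integrable pair_law (case_prod f)"
      using f(2) by (intro integrable_pair_law_bounded[OF f(1), of a]) auto
    show "integrable pair_law (case_prod g)"
      using g(2) by (intro integrable_pair_law_bounded[OF g(1), of b]) auto
    show "case_prod f p \<le> case_prod g p" if "p \<in> space pair_law" for p
      using that le by auto
  qed
  moreover have "P.expectation (case_prod f) = Epair \<mu> K (\<lambda>s s'. case_prod f (s, s'))"
    by (rule integral_pair_law[OF f(1), of a]) (use f(2) in auto)
  moreover have "P.expectation (case_prod g) = Epair \<mu> K (\<lambda>s s'. case_prod g (s, s'))"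
    by (rule integral_pair_law[OF g(1), of b]) (use g(2) in auto)
  ultimately show ?thesis by simp
qed

lemma measure_pair_law_Times:
  assumes A [measurable]: "A \<in> sets \<mu>" and B [measurable]: "B \<in> sets \<mu>"
  shows "measure pair_law (A \<times> B) = (\<integral>s. indicator A s * measure (K s) B \<partial>\<mu>)"
proof -
  interpret P: prob_space pair_law by (rule prob_space_pair_law)
  have "measure pair_law (A \<times> B) = (\<integral>p. indicator (A \<times> B) p \<partial>pair_law)"
    using A B by (simp add: sets.sets_into_space Int_absorb2 Sigma_mono)
  also have "\<dots> = Epair \<mu> K (\<lambda>s s'. indicator (A \<times> B) (s, s'))"
    by (rule integral_pair_law[of _ 1]) (auto simp: indicator_def)
  also have "\<dots> = (\<integral>s. indicator A s * measure (K s) B \<partial>\<mu>)"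
    unfolding Epair_def
  proof (rule Bochner_Integration.integral_cong)
    fix s assume s: "s \<in> space \<mu>"
    have "B \<inter> space (K s) = B" using sets.sets_into_space[OF B] space_K[OF s] by auto
    then show "(\<integral>s'. indicator (A \<times> B) (s, s') \<partial>K s) = indicator A s * measure (K s) B"
      by (simp add: indicator_times)
  qed simp
  finally show ?thesis .
qed

section \<open>From product-set probabilities of a trajectory to the law of one transition\<close>

lemma chain_fun_Cons: "chain_fun K (f # fs) = (\<lambda>s. f s * (\<integral>s'. chain_fun K fs s' \<partial>K s))"
  by (rule ext) simp

lemma measurable_chain_fun:
  assumes "\<And>f. f \<in> set fs \<Longrightarrow> f \<in> borel_measurable \<mu>"
  shows "chain_fun K fs \<in> borel_measurable \<mu>"
  using assms
proof (induction fs)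
  case Nil
  have "chain_fun K [] = (\<lambda>_. 1)" by (rule ext) simp
  then show ?case by simp
next
  case (Cons f fs)
  then have [measurable]: "f \<in> borel_measurable \<mu>" "chain_fun K fs \<in> borel_measurable \<mu>" by auto
  show ?case unfolding chain_fun_Cons by measurable
qed

lemma abs_chain_fun_le_1:
  assumes "\<And>f. f \<in> set fs \<Longrightarrow> f \<in> borel_measurable \<mu>" "\<And>f s. f \<in> set fs \<Longrightarrow> \<bar>f s\<bar> \<le> 1"
    and "s \<in> space \<mu>"
  shows "\<bar>chain_fun K fs s\<bar> \<le> 1"
  using assms
proof (induction fs arbitrary: s)
  case (Cons f fs)
  have "\<bar>\<integral>s'. chain_fun K fs s' \<partial>K s\<bar> \<le> 1"
    using Cons by (intro abs_integral_K_le measurable_chain_fun) auto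
  then show ?case using Cons.prems by (auto simp: abs_mult intro: mult_le_one)
qed simp

lemma chain_fun_replicate_space:
  assumes "s \<in> space \<mu>"
  shows "chain_fun K (replicate m (indicator (space \<mu>))) s = 1"
  using assms
proof (induction m arbitrary: s)
  case (Suc m)
  interpret K: prob_space "K s" using Suc.prems by (rule prob_space_K)
  have "(\<integral>s'. chain_fun K (replicate m (indicator (space \<mu>))) s' \<partial>K s) = (\<integral>s'. 1 \<partial>K s)"
    using Suc by (intro Bochner_Integration.integral_cong) (auto simp: space_K)
  then show ?case using Suc.prems K.prob_space by simp
qed simp

text \<open>Each unconstrained leading period applies \<open>K\<close> once to the remaining
  integrand, and stationarity absorbs it. The bound 1 on the factors supplies the
  integrability.\<close>

lemma integral_chain_fun_prefix:
  assumes "\<And>f. f \<in> set fs \<Longrightarrow> f \<in> borel_measurable \<mu>" "\<And>f s. f \<in> set fs \<Longrightarrow> \<bar>f s\<bar> \<le> 1"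
  shows "(\<integral>s. chain_fun K (replicate m (indicator (space \<mu>)) @ fs) s \<partial>\<mu>) = (\<integral>s. chain_fun K fs s \<partial>\<mu>)"
proof (induction m)
  case (Suc m)
  let ?g = "chain_fun K (replicate m (indicator (space \<mu>)) @ fs)"
  have "(\<integral>s. chain_fun K (replicate (Suc m) (indicator (space \<mu>)) @ fs) s \<partial>\<mu>) = (\<integral>s. \<integral>s'. ?g s' \<partial>K s \<partial>\<mu>)"
    by (intro Bochner_Integration.integral_cong) auto
  also have "\<dots> = (\<integral>s. ?g s \<partial>\<mu>)"
    using assms
    by (intro integral_K_bounded[of _ 1] measurable_chain_fun abs_chain_fun_le_1) (auto split: if_splits)
  finally show ?case using Suc by simp
qed simp

text \<open>Unconstrained periods after the pair integrate to one because each \<open>K s\<close> is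
  a probability measure; those before it disappear by stationarity.\<close>

lemma integral_chain_fun_pair:
  assumes A [measurable]: "A \<in> sets \<mu>" and B [measurable]: "B \<in> sets \<mu>"
  shows "(\<integral>s. chain_fun K (replicate m (indicator (space \<mu>)) @ [indicator A, indicator B]
            @ replicate l (indicator (space \<mu>))) s \<partial>\<mu>) = measure pair_law (A \<times> B)"
proof -
  have inner: "(\<integral>s'. indicator B s' * (\<integral>s''. chain_fun K (replicate l (indicator (space \<mu>))) s'' \<partial>K s') \<partial>K s) = measure (K s) B"
    if s: "s \<in> space \<mu>" for s
  proof -
    have "(\<integral>s''. chain_fun K (replicate l (indicator (space \<mu>))) s'' \<partial>K s') = 1" if s': "s' \<in> space \<mu>" for s'
    proof -
      interpret K: prob_space "K s'" using s' by (rule prob_space_K)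
      have "(\<integral>s''. chain_fun K (replicate l (indicator (space \<mu>))) s'' \<partial>K s') = (\<integral>s''. 1 \<partial>K s')"
        using s' by (intro Bochner_Integration.integral_cong) (auto simp: space_K chain_fun_replicate_space)
      then show ?thesis using K.prob_space by simp
    qed
    then have "(\<integral>s'. indicator B s' * (\<integral>s''. chain_fun K (replicate l (indicator (space \<mu>))) s'' \<partial>K s') \<partial>K s)
        = (\<integral>s'. indicator B s' \<partial>K s)"
      using s by (intro Bochner_Integration.integral_cong) (auto simp: space_K)
    also have "\<dots> = measure (K s) B"
      using sets.sets_into_space[OF B] space_K[OF s] by (simp add: Int_absorb2)
    finally show ?thesis .
  qed
  have "(\<integral>s. chain_fun K (replicate m (indicator (space \<mu>)) @ [indicator A, indicator B]
            @ replicate l (indicator (space \<mu>))) s \<partial>\<mu>)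
      = (\<integral>s. chain_fun K ([indicator A, indicator B] @ replicate l (indicator (space \<mu>))) s \<partial>\<mu>)"
    by (rule integral_chain_fun_prefix) (auto simp: indicator_def split: if_splits)
  also have "\<dots> = (\<integral>s. indicator A s * measure (K s) B \<partial>\<mu>)"
    using inner by (intro Bochner_Integration.integral_cong) (simp_all add: chain_fun_Cons)
  finally show ?thesis by (simp add: measure_pair_law_Times)
qed

text \<open>The law is given on product sets only. Leaving all periods but two unconstrained yields
  the rectangles, an intersection-stable generator of the product sigma-algebra, on which a finite
  measure is determined.\<close>

lemma distr_consecutive_eq_pair_law:
  fixes M :: "'w measure" and X :: "nat \<Rightarrow> 'w \<Rightarrow> 's"
  assumes M: "prob_space M" and X [measurable]: "\<And>t. X t \<in> M \<rightarrow>\<^sub>M \<mu>"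
    and law: "\<And>A. (\<forall>t<T. A t \<in> sets \<mu>) \<Longrightarrow> measure M {\<omega>\<in>space M. \<forall>t<T. X t \<omega> \<in> A t}
                 = (\<integral>s. chain_fun K (map (\<lambda>t. indicator (A t)) [0..<T]) s \<partial>\<mu>)"
    and t: "Suc t < T"
  shows "distr M (\<mu> \<Otimes>\<^sub>M \<mu>) (\<lambda>\<omega>. (X t \<omega>, X (Suc t) \<omega>)) = pair_law" (is "?D = _")
proof -
  interpret M: prob_space M by fact
  interpret P: prob_space pair_law by (rule prob_space_pair_law)
  have XX [measurable]: "(\<lambda>\<omega>. (X t \<omega>, X (Suc t) \<omega>)) \<in> M \<rightarrow>\<^sub>M \<mu> \<Otimes>\<^sub>M \<mu>" by measurable
  interpret D: prob_space ?D by (rule M.prob_space_distr) fact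
  have rect: "measure ?D (A \<times> B) = measure pair_law (A \<times> B)" if A: "A \<in> sets \<mu>" and B: "B \<in> sets \<mu>" for A B
  proof -
    define C where "C = (\<lambda>r. if r = t then A else if r = Suc t then B else space \<mu>)"
    have C: "C r \<in> sets \<mu>" for r using A B by (simp add: C_def)
    have "measure ?D (A \<times> B) = measure M {\<omega>\<in>space M. X t \<omega> \<in> A \<and> X (Suc t) \<omega> \<in> B}"
      using A B by (subst measure_distr) (auto intro!: arg_cong[where f="measure M"])
    also have "{\<omega>\<in>space M. X t \<omega> \<in> A \<and> X (Suc t) \<omega> \<in> B} = {\<omega>\<in>space M. \<forall>r<T. X r \<omega> \<in> C r}"
      using t measurable_space[OF X] by (auto simp: C_def)
    also have "measure M \<dots> = (\<integral>s. chain_fun K (map (\<lambda>r. indicator (C r)) [0..<T]) s \<partial>\<mu>)"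
      by (rule law) (simp add: C)
    also have "map (\<lambda>r. indicator (C r)) [0..<T] = replicate t (indicator (space \<mu>)) @ [indicator A, indicator B]
            @ replicate (T - Suc (Suc t)) (indicator (space \<mu>) :: 's \<Rightarrow> real)"
      using t by (intro nth_equalityI) (auto simp: C_def nth_append nth_Cons split: nat.split)
    finally show ?thesis unfolding integral_chain_fun_pair[OF A B] .
  qed
  show ?thesis
  proof (rule measure_eqI_generator_eq[OF Int_stable_pair_measure_generator[of \<mu> \<mu>], where A="\<lambda>_. space \<mu> \<times> space \<mu>"])
    fix R assume "R \<in> {a \<times> b | a b. a \<in> sets \<mu> \<and> b \<in> sets \<mu>}"
    then show "emeasure ?D R = emeasure pair_law R"
      using rect by (auto simp: D.emeasure_eq_measure P.emeasure_eq_measure)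
  next
    show "sets ?D = sigma_sets (space \<mu> \<times> space \<mu>) {a \<times> b |a b. a \<in> sets \<mu> \<and> b \<in> sets \<mu>}"
      by (simp only: sets_distr sets_pair_measure)
    show "sets pair_law = sigma_sets (space \<mu> \<times> space \<mu>) {a \<times> b |a b. a \<in> sets \<mu> \<and> b \<in> sets \<mu>}"
      by (simp only: sets_pair_law sets_pair_measure)
    show "emeasure ?D (space \<mu> \<times> space \<mu>) \<noteq> \<infinity>" for i :: nat
      by (simp only: D.emeasure_eq_measure) simp
  qed (use sets.space_closed in auto)
qed

end

subsection \<open>Empirical means over independent chains\<close>

text \<open>Cross terms factor by independence and vanish by centring. Integrability is part of the
  conclusion because the induction step needs it for the partial sum.\<close>

lemma (in prob_space) expectation_square_sum_indep:
  fixes X :: "'i \<Rightarrow> 'a \<Rightarrow> real"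
  assumes "finite I" "indep_vars (\<lambda>_. borel) X I"
    and "\<And>i. i \<in> I \<Longrightarrow> integrable M (\<lambda>\<omega>. (X i \<omega>)\<^sup>2)" "\<And>i. i \<in> I \<Longrightarrow> expectation (X i) = 0"
  shows "integrable M (\<lambda>\<omega>. (\<Sum>i\<in>I. X i \<omega>)\<^sup>2) \<and>
    expectation (\<lambda>\<omega>. (\<Sum>i\<in>I. X i \<omega>)\<^sup>2) = (\<Sum>i\<in>I. expectation (\<lambda>\<omega>. (X i \<omega>)\<^sup>2))"
  using assms
proof (induction I rule: finite_induct)
  case (insert i I)
  have rv [measurable]: "X j \<in> borel_measurable M" if "j \<in> insert i I" for j
    using insert.prems(1) that by (auto simp: indep_vars_def)
  have int: "integrable M (X j)" if "j \<in> insert i I" for j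
    using that insert.prems(2) rv by (metis integrable_if_square_integrable)
  have IH: "integrable M (\<lambda>\<omega>. (\<Sum>i\<in>I. X i \<omega>)\<^sup>2)"
    "expectation (\<lambda>\<omega>. (\<Sum>i\<in>I. X i \<omega>)\<^sup>2) = (\<Sum>i\<in>I. expectation (\<lambda>\<omega>. (X i \<omega>)\<^sup>2))"
    using insert.IH insert.prems indep_vars_subset[OF insert.prems(1)] by auto
  have ind: "indep_var borel (X i) borel (\<lambda>\<omega>. \<Sum>i\<in>I. X i \<omega>)"
    using insert by (intro indep_vars_sum) auto
  have S: "integrable M (\<lambda>\<omega>. \<Sum>i\<in>I. X i \<omega>)" using int by auto
  have "integrable M (\<lambda>\<omega>. X i \<omega> * (\<Sum>i\<in>I. X i \<omega>))"
    using indep_var_integrable[OF ind] int S by auto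
  moreover have "expectation (\<lambda>\<omega>. X i \<omega> * (\<Sum>i\<in>I. X i \<omega>)) = 0"
    using indep_var_lebesgue_integral[OF ind] int S insert.prems(3) by auto
  moreover have "integrable M (\<lambda>\<omega>. (X i \<omega>)\<^sup>2)" using insert.prems by auto
  moreover have "(\<Sum>j\<in>insert i I. X j \<omega>)\<^sup>2 =
      (X i \<omega>)\<^sup>2 + (\<Sum>i\<in>I. X i \<omega>)\<^sup>2 + 2 * (X i \<omega> * (\<Sum>i\<in>I. X i \<omega>))" for \<omega>
    using insert.hyps by (simp add: power2_sum)
  ultimately show ?case using IH insert.hyps by simp
qed simp

locale markov_panel = stationary_kernel \<mu> K + M: prob_space M
  for \<mu> :: "'s measure" and K and M :: "'w measure" +
  fixes Y :: "nat \<Rightarrow> nat \<Rightarrow> 'w \<Rightarrow> 's" and T :: nat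
  assumes T: "2 \<le> T"
    and Y_meas [measurable]: "\<And>i t. Y i t \<in> M \<rightarrow>\<^sub>M \<mu>"
    and Y_indep: "M.indep_vars (\<lambda>_. PiM {..<T} (\<lambda>_. \<mu>)) (\<lambda>i \<omega>. \<lambda>t\<in>{..<T}. Y i t \<omega>) UNIV"
    and Y_law: "\<And>i A. (\<forall>t<T. A t \<in> sets \<mu>) \<Longrightarrow>
                 measure M {\<omega>\<in>space M. \<forall>t<T. Y i t \<omega> \<in> A t}
                 = (\<integral>s. chain_fun K (map (\<lambda>t. indicator (A t)) [0..<T]) s \<partial>\<mu>)"
begin

lemma distr_consecutive:
  assumes "t < T - 1"
  shows "distr M (\<mu> \<Otimes>\<^sub>M \<mu>) (\<lambda>\<omega>. (Y i t \<omega>, Y i (Suc t) \<omega>)) = pair_law"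
proof (rule distr_consecutive_eq_pair_law)
  show "prob_space M" by unfold_locales
  show "Suc t < T" using assms by simp
qed (use Y_law in auto)

lemma expectation_consecutive:
  fixes f :: "'s \<Rightarrow> 's \<Rightarrow> real"
  assumes f [measurable]: "case_prod f \<in> borel_measurable (\<mu> \<Otimes>\<^sub>M \<mu>)"
    and b: "\<And>s s'. s \<in> space \<mu> \<Longrightarrow> s' \<in> space \<mu> \<Longrightarrow> \<bar>f s s'\<bar> \<le> b"
    and t: "t < T - 1"
  shows "M.expectation (\<lambda>\<omega>. f (Y i t \<omega>) (Y i (Suc t) \<omega>)) = Epair \<mu> K f"
proof -
  have "M.expectation (\<lambda>\<omega>. case_prod f (Y i t \<omega>, Y i (Suc t) \<omega>)) = (\<integral>p. case_prod f p \<partial>pair_law)"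
    unfolding distr_consecutive[OF t, of i, symmetric] by (intro integral_distr[symmetric]) measurable
  also have "\<dots> = Epair \<mu> K (\<lambda>s s'. case_prod f (s, s'))"
    by (rule integral_pair_law[OF f]) (use b in auto)
  finally show ?thesis by simp
qed

lemma measurable_consecutive:
  fixes f :: "'s \<Rightarrow> 's \<Rightarrow> real"
  assumes [measurable]: "case_prod f \<in> borel_measurable (\<mu> \<Otimes>\<^sub>M \<mu>)"
  shows "(\<lambda>\<omega>. f (Y i t \<omega>) (Y i (Suc t) \<omega>)) \<in> borel_measurable M"
proof -
  have "(\<lambda>\<omega>. case_prod f (Y i t \<omega>, Y i (Suc t) \<omega>)) \<in> borel_measurable M" by measurable
  then show ?thesis by simp
qed

lemma bounded_integrable:
  fixes g :: "'w \<Rightarrow> real"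
  assumes "g \<in> borel_measurable M" "\<And>\<omega>. \<omega> \<in> space M \<Longrightarrow> \<bar>g \<omega>\<bar> \<le> b"
  shows "integrable M g"
  using assms by (intro M.integrable_const_bound[of _ b]) auto

lemma indep_individual_sums:
  fixes f :: "'s \<Rightarrow> 's \<Rightarrow> real"
  assumes f [measurable]: "case_prod f \<in> borel_measurable (\<mu> \<Otimes>\<^sub>M \<mu>)"
  shows "M.indep_vars (\<lambda>_. borel) (\<lambda>i \<omega>. \<Sum>t<T - 1. f (Y i t \<omega>) (Y i (Suc t) \<omega>)) UNIV"
proof -
  have "(\<lambda>y. case_prod f (y t, y (Suc t))) \<in> borel_measurable (PiM {..<T} (\<lambda>_. \<mu>))" if "t < T - 1" for t
  proof -
    have "(\<lambda>y. (y t, y (Suc t))) \<in> PiM {..<T} (\<lambda>_. \<mu>) \<rightarrow>\<^sub>M \<mu> \<Otimes>\<^sub>M \<mu>"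
      using that by (intro measurable_Pair measurable_component_singleton) auto
    from measurable_compose[OF this f] show ?thesis by simp
  qed
  then have "(\<lambda>y. \<Sum>t<T - 1. case_prod f (y t, y (Suc t))) \<in> borel_measurable (PiM {..<T} (\<lambda>_. \<mu>))"
    by (intro borel_measurable_sum) auto
  from M.indep_vars_compose2[OF Y_indep this]
  have "M.indep_vars (\<lambda>_. borel)
      (\<lambda>i \<omega>. \<Sum>t<T - 1. case_prod f ((\<lambda>t\<in>{..<T}. Y i t \<omega>) t, (\<lambda>t\<in>{..<T}. Y i t \<omega>) (Suc t))) UNIV" .
  \<comment> \<open>For \<open>t < T - 1\<close> both \<open>t\<close> and \<open>Suc t\<close> lie
    below \<open>T\<close>, so the restriction of the trajectory changes nothing.\<close>
  moreover have "(\<Sum>t<T - 1. case_prod f ((\<lambda>t\<in>{..<T}. Y i t \<omega>) t, (\<lambda>t\<in>{..<T}. Y i t \<omega>) (Suc t)))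
      = (\<Sum>t<T - 1. f (Y i t \<omega>) (Y i (Suc t) \<omega>))" for i \<omega>
    by (intro sum.cong) auto
  ultimately show ?thesis by (simp only:)
qed

text \<open>The transitions of one individual overlap and are dependent, so the second moment is
  bounded by Cauchy-Schwarz over the \<open>T - 1\<close> periods instead of being expanded.\<close>

lemma individual_sum_moments:
  fixes f :: "'s \<Rightarrow> 's \<Rightarrow> real"
  assumes f [measurable]: "case_prod f \<in> borel_measurable (\<mu> \<Otimes>\<^sub>M \<mu>)"
    and b: "\<And>s s'. s \<in> space \<mu> \<Longrightarrow> s' \<in> space \<mu> \<Longrightarrow> \<bar>f s s'\<bar> \<le> b"
  defines "X \<equiv> \<lambda>i \<omega>. \<Sum>t<T - 1. f (Y i t \<omega>) (Y i (Suc t) \<omega>)"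
  shows "M.expectation (X i) = real (T - 1) * Epair \<mu> K f"
    and "integrable M (\<lambda>\<omega>. (X i \<omega>)\<^sup>2)"
    and "M.expectation (\<lambda>\<omega>. (X i \<omega>)\<^sup>2) \<le> (real (T - 1))\<^sup>2 * Epair \<mu> K (\<lambda>s s'. (f s s')\<^sup>2)"
proof -
  let ?g = "\<lambda>t \<omega>. f (Y i t \<omega>) (Y i (Suc t) \<omega>)"
  note m [measurable] = measurable_consecutive[OF f]
  have gb: "\<bar>?g t \<omega>\<bar> \<le> b" if "\<omega> \<in> space M" for t \<omega>
    using b measurable_space[OF Y_meas that] by auto
  then have gb2: "\<bar>(?g t \<omega>)\<^sup>2\<bar> \<le> b\<^sup>2" if "\<omega> \<in> space M" for t \<omega>
    using power_mono[OF gb[OF that, of t], of 2] by simp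
  have gint: "integrable M (?g t)" for t
    using gb by (intro bounded_integrable) auto
  have gint2: "integrable M (\<lambda>\<omega>. (?g t \<omega>)\<^sup>2)" for t
    using gb2 by (intro bounded_integrable[of _ "b\<^sup>2"]) auto
  show "M.expectation (X i) = real (T - 1) * Epair \<mu> K f"
    using gint expectation_consecutive[OF f b] by (simp add: X_def)
  have CS: "(X i \<omega>)\<^sup>2 \<le> real (T - 1) * (\<Sum>t<T - 1. (?g t \<omega>)\<^sup>2)" for \<omega>
    unfolding X_def using sum_squared_le_sum_of_squares[of "\<lambda>t. ?g t \<omega>" "{..<T - 1}"] by (simp add: mult.commute)
  show int: "integrable M (\<lambda>\<omega>. (X i \<omega>)\<^sup>2)"
  proof (rule Bochner_Integration.integrable_bound)
    show "integrable M (\<lambda>\<omega>. real (T - 1) * (\<Sum>t<T - 1. (?g t \<omega>)\<^sup>2))"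
      using gint2 by (intro integrable_mult_right Bochner_Integration.integrable_sum) 
    show "(\<lambda>\<omega>. (X i \<omega>)\<^sup>2) \<in> borel_measurable M" unfolding X_def by measurable
    show "AE \<omega> in M. norm ((X i \<omega>)\<^sup>2) \<le> norm (real (T - 1) * (\<Sum>t<T - 1. (?g t \<omega>)\<^sup>2))"
      using CS by (intro AE_I2) (auto simp: sum_nonneg intro: order.trans[OF _ abs_ge_self])
  qed
  have "M.expectation (\<lambda>\<omega>. (X i \<omega>)\<^sup>2) \<le> M.expectation (\<lambda>\<omega>. real (T - 1) * (\<Sum>t<T - 1. (?g t \<omega>)\<^sup>2))"
    using int CS gint2 by (intro integral_mono integrable_mult_right Bochner_Integration.integrable_sum) auto
  also have "\<dots> = real (T - 1) * (\<Sum>t<T - 1. M.expectation (\<lambda>\<omega>. (?g t \<omega>)\<^sup>2))"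
    using gint2 by simp
  also have "\<dots> = real (T - 1) * (\<Sum>t<T - 1. Epair \<mu> K (\<lambda>s s'. (f s s')\<^sup>2))"
  proof -
    have "M.expectation (\<lambda>\<omega>. (?g t \<omega>)\<^sup>2) = Epair \<mu> K (\<lambda>s s'. (f s s')\<^sup>2)" if "t < T - 1" for t
    proof (rule expectation_consecutive[of "\<lambda>s s'. (f s s')\<^sup>2" "b\<^sup>2", OF _ _ that])
      show "(\<lambda>(s, s'). (f s s')\<^sup>2) \<in> borel_measurable (\<mu> \<Otimes>\<^sub>M \<mu>)"
        using borel_measurable_power[OF f, of 2] by (simp add: case_prod_beta')
      show "\<bar>(f s s')\<^sup>2\<bar> \<le> b\<^sup>2" if "s \<in> space \<mu>" "s' \<in> space \<mu>" for s s'
        using power_mono[OF b[OF that], of 2] by simp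
    qed
    then show ?thesis by simp
  qed
  finally show "M.expectation (\<lambda>\<omega>. (X i \<omega>)\<^sup>2) \<le> (real (T - 1))\<^sup>2 * Epair \<mu> K (\<lambda>s s'. (f s s')\<^sup>2)"
    by (simp add: power2_eq_square)
qed

text \<open>The square of \<open>T - 1\<close> lost within each individual cancels against the
  normalisation, and summing over n independent individuals leaves 1/n. The bound \<open>b\<close>
  only secures integrability; the estimate involves the second moment alone, which matters when the
  supremum grows with the dimension.\<close>

lemma En_mean_square_centered:
  fixes f :: "'s \<Rightarrow> 's \<Rightarrow> real"
  assumes f: "case_prod f \<in> borel_measurable (\<mu> \<Otimes>\<^sub>M \<mu>)"
    and b: "\<And>s s'. s \<in> space \<mu> \<Longrightarrow> s' \<in> space \<mu> \<Longrightarrow> \<bar>f s s'\<bar> \<le> b"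
    and centered: "Epair \<mu> K f = 0" and n: "0 < n"
  shows "integrable M (\<lambda>\<omega>. (En Y T n \<omega> f)\<^sup>2)"
    and "M.expectation (\<lambda>\<omega>. (En Y T n \<omega> f)\<^sup>2) \<le> Epair \<mu> K (\<lambda>s s'. (f s s')\<^sup>2) / real n"
proof -
  define X where "X = (\<lambda>i \<omega>. \<Sum>t<T - 1. f (Y i t \<omega>) (Y i (Suc t) \<omega>))"
  define V where "V = Epair \<mu> K (\<lambda>s s'. (f s s')\<^sup>2)"
  have mom: "M.expectation (X i) = 0" "integrable M (\<lambda>\<omega>. (X i \<omega>)\<^sup>2)"
      "M.expectation (\<lambda>\<omega>. (X i \<omega>)\<^sup>2) \<le> (real (T - 1))\<^sup>2 * V" for i
    unfolding X_def V_def using individual_sum_moments[OF f b] centered by simp_all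
  have "M.indep_vars (\<lambda>_. borel) X {..<n}"
    using M.indep_vars_subset[OF indep_individual_sums[OF f]] by (simp add: X_def)
  then have sq: "integrable M (\<lambda>\<omega>. (\<Sum>i<n. X i \<omega>)\<^sup>2)"
    "M.expectation (\<lambda>\<omega>. (\<Sum>i<n. X i \<omega>)\<^sup>2) = (\<Sum>i<n. M.expectation (\<lambda>\<omega>. (X i \<omega>)\<^sup>2))"
    using M.expectation_square_sum_indep[of "{..<n}" X] mom(1,2) by auto
  have En: "(En Y T n \<omega> f)\<^sup>2 = (\<Sum>i<n. X i \<omega>)\<^sup>2 / (real n * real (T - 1))\<^sup>2" for \<omega>
    by (simp add: En_def X_def power_divide)
  show "integrable M (\<lambda>\<omega>. (En Y T n \<omega> f)\<^sup>2)" using sq(1) by (simp add: En)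
  have "M.expectation (\<lambda>\<omega>. (\<Sum>i<n. X i \<omega>)\<^sup>2) \<le> (\<Sum>i<n. (real (T - 1))\<^sup>2 * V)"
    unfolding sq(2) by (intro sum_mono mom(3))
  then have "M.expectation (\<lambda>\<omega>. (En Y T n \<omega> f)\<^sup>2) \<le> (\<Sum>i<n. (real (T - 1))\<^sup>2 * V) / (real n * real (T - 1))\<^sup>2"
    unfolding En using sq(1) by (simp add: divide_right_mono)
  also have "\<dots> = V / real n"
  proof -
    have "(\<Sum>i<n. N\<^sup>2 * V) / (real n * N)\<^sup>2 = V / real n" if "0 < N" for N :: real
      using n that by (simp add: power2_eq_square field_simps)
    \<comment> \<open>\<open>T - 1\<close> is positive because \<open>T\<close> is at least
      2.\<close>
    then show ?thesis using T by simp
  qed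
  finally show "M.expectation (\<lambda>\<omega>. (En Y T n \<omega> f)\<^sup>2) \<le> Epair \<mu> K (\<lambda>s s'. (f s s')\<^sup>2) / real n"
    by (simp add: V_def)
qed

text \<open>Centre f and apply the previous bound; the variance is at most the raw second moment,
  hence at most b^2. Meant for matrix entries, whose supremum bound does not depend on the
  dimension.\<close>

lemma En_mean_square:
  fixes f :: "'s \<Rightarrow> 's \<Rightarrow> real"
  assumes f: "case_prod f \<in> borel_measurable (\<mu> \<Otimes>\<^sub>M \<mu>)"
    and b: "\<And>s s'. s \<in> space \<mu> \<Longrightarrow> s' \<in> space \<mu> \<Longrightarrow> \<bar>f s s'\<bar> \<le> b"
    and n: "0 < n"
  shows "integrable M (\<lambda>\<omega>. (En Y T n \<omega> f - Epair \<mu> K f)\<^sup>2)"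
    and "M.expectation (\<lambda>\<omega>. (En Y T n \<omega> f - Epair \<mu> K f)\<^sup>2) \<le> b\<^sup>2 / real n"
proof -
  interpret P: prob_space pair_law by (rule prob_space_pair_law)
  define m where "m = Epair \<mu> K f"
  have m: "m = P.expectation (case_prod f)"
    using integral_pair_law[OF f, of b] b unfolding m_def by auto
  have fint: "integrable pair_law (case_prod f)"
    using b by (intro integrable_pair_law_bounded[OF f, of b]) auto
  have g: "case_prod (\<lambda>s s'. f s s' - m) \<in> borel_measurable (\<mu> \<Otimes>\<^sub>M \<mu>)"
    using borel_measurable_diff[OF f borel_measurable_const[of m]] by (simp add: case_prod_beta')
  have gb: "\<bar>f s s' - m\<bar> \<le> b + \<bar>m\<bar>" if "s \<in> space \<mu>" "s' \<in> space \<mu>" for s s'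
    using b[OF that] by linarith
  have sb: "(f s s')\<^sup>2 \<le> b\<^sup>2" if "s \<in> space \<mu>" "s' \<in> space \<mu>" for s s'
    using power_mono[OF b[OF that], of 2] by simp
  have f2: "(\<lambda>p. (case_prod f p)\<^sup>2) \<in> borel_measurable (\<mu> \<Otimes>\<^sub>M \<mu>)"
    using borel_measurable_power[OF f, of 2] .
  have f2int: "integrable pair_law (\<lambda>p. (case_prod f p)\<^sup>2)"
    using sb by (intro integrable_pair_law_bounded[OF f2, of "b\<^sup>2"]) auto
  have "Epair \<mu> K (\<lambda>s s'. f s s' - m) = P.expectation (\<lambda>p. case_prod f p - m)"
  proof -
    have "(\<integral>p. case_prod (\<lambda>s s'. f s s' - m) p \<partial>pair_law) = Epair \<mu> K (\<lambda>s s'. case_prod (\<lambda>s s'. f s s' - m) (s, s'))"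
      by (rule integral_pair_law[OF g, of "b + \<bar>m\<bar>"]) (use gb in auto)
    then show ?thesis by (simp add: case_prod_beta')
  qed
  also have "\<dots> = 0" using fint P.prob_space by (simp add: m)
  finally have centered: "Epair \<mu> K (\<lambda>s s'. f s s' - m) = 0" .
  \<comment> \<open>The empirical mean of a constant is that constant only when the denominator is
    nonzero, whence \<open>n\<close> and \<open>T\<close> in the proof.\<close>
  have "(En Y T n \<omega> (\<lambda>s s'. f s s' - m)) = En Y T n \<omega> f - m" for \<omega>
    using n T by (simp add: En_def sum_subtractf diff_divide_distrib)
  note * = En_mean_square_centered[OF g gb centered n, unfolded this]
  show "integrable M (\<lambda>\<omega>. (En Y T n \<omega> f - Epair \<mu> K f)\<^sup>2)"
    using *(1) by (simp add: m_def)
  have "Epair \<mu> K (\<lambda>s s'. (f s s' - m)\<^sup>2) = P.expectation (\<lambda>p. (case_prod f p - m)\<^sup>2)"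
  proof -
    have "(\<lambda>p. (case_prod f p - m)\<^sup>2) \<in> borel_measurable (\<mu> \<Otimes>\<^sub>M \<mu>)"
      by (intro borel_measurable_power borel_measurable_diff f) simp
    moreover have "\<bar>(case_prod f p - m)\<^sup>2\<bar> \<le> (b + \<bar>m\<bar>)\<^sup>2" if "p \<in> space \<mu> \<times> space \<mu>" for p
    proof -
      have "\<bar>f (fst p) (snd p) - m\<bar> \<le> b + \<bar>m\<bar>" using that by (intro gb) auto
      from power_mono[OF this, of 2] show ?thesis by (simp add: case_prod_beta)
    qed
    ultimately show ?thesis using integral_pair_law[of "\<lambda>p. (case_prod f p - m)\<^sup>2" "(b + \<bar>m\<bar>)\<^sup>2"] by simp
  qed
  also have "\<dots> = P.expectation (\<lambda>p. (case_prod f p)\<^sup>2) - m\<^sup>2"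
    using P.variance_eq[OF fint f2int] by (simp add: m)
  also have "\<dots> \<le> P.expectation (\<lambda>p. (case_prod f p)\<^sup>2)" by simp
  also have "\<dots> \<le> b\<^sup>2"
    using sb by (intro P.integral_le_const f2int AE_I2) auto
  finally have "Epair \<mu> K (\<lambda>s s'. (f s s' - m)\<^sup>2) \<le> b\<^sup>2" .
  then have "Epair \<mu> K (\<lambda>s s'. (f s s' - m)\<^sup>2) / real n \<le> b\<^sup>2 / real n"
    by (rule divide_right_mono) simp
  then show "M.expectation (\<lambda>\<omega>. (En Y T n \<omega> f - Epair \<mu> K f)\<^sup>2) \<le> b\<^sup>2 / real n"
    using *(2) by (simp add: m_def)
qed

end

subsection \<open>The population problem\<close>

context stationary_kernel
begin

text \<open>An algebra of functions that \<open>K\<close> maps into itself. The sieve functions and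
  \<open>z\<close> belong to it, which discharges their integrability conditions by closure; h is
  handled through square integrability.\<close>

definition bounded_measurable :: "('s \<Rightarrow> real) \<Rightarrow> bool" where
  "bounded_measurable f \<longleftrightarrow> f \<in> borel_measurable \<mu> \<and> (\<exists>b. \<forall>s\<in>space \<mu>. \<bar>f s\<bar> \<le> b)"

lemma bounded_measurableI:
  assumes "f \<in> borel_measurable \<mu>" "\<And>s. s \<in> space \<mu> \<Longrightarrow> \<bar>f s\<bar> \<le> b"
  shows "bounded_measurable f"
  unfolding bounded_measurable_def using assms by blast

lemma bounded_measurable_measurable: "bounded_measurable f \<Longrightarrow> f \<in> borel_measurable \<mu>"
  by (simp add: bounded_measurable_def)

lemma bounded_measurable_const: "bounded_measurable (\<lambda>_. a)"
  by (auto simp: bounded_measurable_def)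

lemma bounded_measurable_mult:
  assumes "bounded_measurable f" "bounded_measurable g"
  shows "bounded_measurable (\<lambda>s. f s * g s)"
proof -
  obtain a b where a: "\<And>s. s \<in> space \<mu> \<Longrightarrow> \<bar>f s\<bar> \<le> a" and b: "\<And>s. s \<in> space \<mu> \<Longrightarrow> \<bar>g s\<bar> \<le> b"
    using assms by (auto simp: bounded_measurable_def)
  have "\<bar>f s * g s\<bar> \<le> a * b" if "s \<in> space \<mu>" for s
    unfolding abs_mult using a[OF that] b[OF that] by (intro mult_mono) auto
  with borel_measurable_times[OF bounded_measurable_measurable[OF assms(1)] bounded_measurable_measurable[OF assms(2)]]
  show ?thesis by (rule bounded_measurableI)
qed

lemma bounded_measurable_add:
  assumes "bounded_measurable f" "bounded_measurable g"
  shows "bounded_measurable (\<lambda>s. f s + g s)"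
proof -
  obtain a b where a: "\<And>s. s \<in> space \<mu> \<Longrightarrow> \<bar>f s\<bar> \<le> a" and b: "\<And>s. s \<in> space \<mu> \<Longrightarrow> \<bar>g s\<bar> \<le> b"
    using assms by (auto simp: bounded_measurable_def)
  have "\<bar>f s + g s\<bar> \<le> a + b" if "s \<in> space \<mu>" for s
    using a[OF that] b[OF that] by linarith
  with borel_measurable_add[OF bounded_measurable_measurable[OF assms(1)] bounded_measurable_measurable[OF assms(2)]]
  show ?thesis by (rule bounded_measurableI)
qed

lemma bounded_measurable_diff:
  assumes "bounded_measurable f" "bounded_measurable g"
  shows "bounded_measurable (\<lambda>s. f s - g s)"
  using bounded_measurable_add[OF assms(1) bounded_measurable_mult[OF bounded_measurable_const[of "-1"] assms(2)]]
  by (simp only: mult_minus1 add_uminus_conv_diff)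

lemma bounded_measurable_sum:
  assumes "\<And>i. i \<in> I \<Longrightarrow> bounded_measurable (f i)"
  shows "bounded_measurable (\<lambda>s. \<Sum>i\<in>I. f i s)"
  using assms
proof (induction I rule: infinite_finite_induct)
  case (insert i I)
  then have "bounded_measurable (\<lambda>s. f i s + (\<Sum>i\<in>I. f i s))"
    by (intro bounded_measurable_add) simp_all
  then show ?case using insert.hyps by simp
qed (simp_all add: bounded_measurable_const)

lemma bounded_measurable_integral_K:
  assumes "bounded_measurable f"
  shows "bounded_measurable (\<lambda>s. \<integral>s'. f s' \<partial>K s)"
proof -
  obtain b where b: "\<And>s. s \<in> space \<mu> \<Longrightarrow> \<bar>f s\<bar> \<le> b"
    using assms by (auto simp: bounded_measurable_def)
  note m = bounded_measurable_measurable[OF assms]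
  show ?thesis
    using abs_integral_K_le[OF _ m b] measurable_integral_K[OF m] by (intro bounded_measurableI) auto
qed

lemmas bounded_measurable_intros = bounded_measurable_const bounded_measurable_mult
  bounded_measurable_add bounded_measurable_diff bounded_measurable_sum bounded_measurable_integral_K

lemma bounded_measurable_integrable:
  assumes "bounded_measurable f"
  shows "integrable \<mu> f"
proof -
  obtain b where "\<And>s. s \<in> space \<mu> \<Longrightarrow> \<bar>f s\<bar> \<le> b"
    using assms by (auto simp: bounded_measurable_def)
  then show ?thesis
    using assms by (intro integrable_const_bound[of _ b] bounded_measurable_measurable) auto
qed

lemma bounded_measurable_square_integrable:
  assumes "bounded_measurable f"
  shows "integrable \<mu> (\<lambda>s. (f s)\<^sup>2)"
  using bounded_measurable_integrable[OF bounded_measurable_mult[OF assms assms]]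
  by (simp add: power2_eq_square)

lemma bounded_measurable_integrable_K:
  assumes "bounded_measurable f" and s: "s \<in> space \<mu>"
  shows "integrable (K s) f"
proof -
  interpret K: prob_space "K s" using s by (rule prob_space_K)
  obtain b where "\<And>s. s \<in> space \<mu> \<Longrightarrow> \<bar>f s\<bar> \<le> b"
    using assms by (auto simp: bounded_measurable_def)
  then show ?thesis
    using measurable_K[OF s bounded_measurable_measurable[OF assms(1)]]
    by (intro K.integrable_const_bound[of _ b]) (auto simp: space_K[OF s])
qed

text \<open>Integrates out the second state, since everything but \<open>f\<close> is constant under
  \<open>K s\<close>. The shape serves three uses: \<open>b\<close> is \<open>- \<beta>\<close> for
  matrix entries, \<open>\<beta>\<close> for the moments and 1 for their squares.\<close>

lemma Epair_residual:
  assumes g: "bounded_measurable g" and f: "bounded_measurable f"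
  shows "Epair \<mu> K (\<lambda>s s'. \<psi> s * (g s + b * f s')) = (\<integral>s. \<psi> s * (g s + b * (\<integral>s'. f s' \<partial>K s)) \<partial>\<mu>)"
  unfolding Epair_def
proof (rule Bochner_Integration.integral_cong)
  fix s assume s: "s \<in> space \<mu>"
  interpret K: prob_space "K s" using s by (rule prob_space_K)
  show "(\<integral>s'. \<psi> s * (g s + b * f s') \<partial>K s) = \<psi> s * (g s + b * (\<integral>s'. f s' \<partial>K s))"
    using bounded_measurable_integrable_K[OF f s] K.prob_space by simp
qed simp

text \<open>Cauchy-Schwarz in its arithmetic-mean form combined with the contraction. The bound is
  linear in squared norms, so later estimates are linear inequalities between squared norms.\<close>

lemma cross_integral_K_le:
  fixes d e :: "'s \<Rightarrow> real"
  assumes d [measurable]: "d \<in> borel_measurable \<mu>" and d2: "integrable \<mu> (\<lambda>s. (d s)\<^sup>2)"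
    and e [measurable]: "e \<in> borel_measurable \<mu>" and e2: "integrable \<mu> (\<lambda>s. (e s)\<^sup>2)"
  shows "\<bar>\<integral>s. d s * (\<integral>s'. e s' \<partial>K s) \<partial>\<mu>\<bar> \<le> ((\<integral>s. (d s)\<^sup>2 \<partial>\<mu>) + (\<integral>s. (e s)\<^sup>2 \<partial>\<mu>)) / 2"
proof -
  let ?k = "\<lambda>s. \<integral>s'. e s' \<partial>K s"
  note k2 = square_integrable_integral_K[OF e e2]
  have "\<bar>\<integral>s. d s * ?k s \<partial>\<mu>\<bar> \<le> (\<integral>s. \<bar>d s * ?k s\<bar> \<partial>\<mu>)"
    using integral_norm_bound[of \<mu> "\<lambda>s. d s * ?k s"] by simp
  also have "\<dots> \<le> (\<integral>s. ((d s)\<^sup>2 + (?k s)\<^sup>2) / 2 \<partial>\<mu>)"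
  proof (rule integral_mono)
    show "integrable \<mu> (\<lambda>s. \<bar>d s * ?k s\<bar>)"
      using d2 k2 by (intro integrable_abs integrable_mult_if_square_integrable) measurable
    show "integrable \<mu> (\<lambda>s. ((d s)\<^sup>2 + (?k s)\<^sup>2) / 2)" using d2 k2 by simp
    show "\<bar>d s * ?k s\<bar> \<le> ((d s)\<^sup>2 + (?k s)\<^sup>2) / 2" for s
      using sum_squares_bound[of "\<bar>d s\<bar>" "\<bar>?k s\<bar>"] by (simp add: abs_mult mult.assoc)
  qed
  also have "\<dots> = ((\<integral>s. (d s)\<^sup>2 \<partial>\<mu>) + (\<integral>s. (?k s)\<^sup>2 \<partial>\<mu>)) / 2"
    using d2 k2 by simp
  also have "\<dots> \<le> ((\<integral>s. (d s)\<^sup>2 \<partial>\<mu>) + (\<integral>s. (e s)\<^sup>2 \<partial>\<mu>)) / 2"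
    using integral_K_contraction[OF e e2] by simp
  finally show ?thesis .
qed

end

text \<open>The matrix that \<open>omega_star\<close> inverts. It is the negative of
  \<open>Amat\<close>, with the sign that makes the quadratic form coercive.\<close>

definition Bmat :: "'s measure \<Rightarrow> ('s \<Rightarrow> 's measure) \<Rightarrow> real \<Rightarrow> nat \<Rightarrow> (nat \<Rightarrow> 's \<Rightarrow> real) \<Rightarrow> real mat" where
  "Bmat \<mu> K \<beta> k ph = mat k k (\<lambda>(i,j). Epair \<mu> K (\<lambda>s s'. ph i s * (ph j s - \<beta> * ph j s')))"

text \<open>One sample size is frozen here. \<open>c\<close> and \<open>b\<close> are parameters, so
  that bounds explicit in \<open>k\<close>, \<open>c\<close> and \<open>b\<close> become uniform in
  n when the locale is instantiated with the same constants for every n.\<close>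

locale sieve = stationary_kernel \<mu> K for \<mu> :: "'s measure" and K +
  fixes \<beta> :: real and k :: nat and ph :: "nat \<Rightarrow> 's \<Rightarrow> real" and c b :: real
  assumes beta: "0 < \<beta>" "\<beta> < 1"
    and ph_meas [measurable]: "\<And>j. ph j \<in> borel_measurable \<mu>"
    and ph_bound: "\<And>j s. j < k \<Longrightarrow> \<bar>ph j s\<bar> \<le> b"
    and c: "0 < c" and eig: "\<And>e. eigenvalue (Gram \<mu> k ph) e \<Longrightarrow> c \<le> e"
begin

section \<open>Sieve functions and their Gram matrix\<close>

lemma bounded_measurable_ph: "j < k \<Longrightarrow> bounded_measurable (ph j)"
  using ph_bound ph_meas by (intro bounded_measurableI)

lemma bounded_measurable_lincomb: "bounded_measurable (lincomb k ph w)"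
  unfolding lincomb_def by (intro bounded_measurable_intros bounded_measurable_ph) simp

lemmas measurable_lincomb [measurable] = bounded_measurable_measurable[OF bounded_measurable_lincomb]
lemmas square_integrable_lincomb = bounded_measurable_square_integrable[OF bounded_measurable_lincomb]

lemma integral_lincomb_mult:
  assumes g [measurable]: "g \<in> borel_measurable \<mu>" and "integrable \<mu> (\<lambda>s. (g s)\<^sup>2)"
  shows "(\<integral>s. lincomb k ph v s * g s \<partial>\<mu>) = (\<Sum>i<k. v $ i * (\<integral>s. ph i s * g s \<partial>\<mu>))"
proof -
  have "integrable \<mu> (\<lambda>s. ph i s * g s)" if "i < k" for i
    using that assms bounded_measurable_square_integrable[OF bounded_measurable_ph]
    by (intro integrable_mult_if_square_integrable) auto
  then have "(\<Sum>i<k. v $ i * (\<integral>s. ph i s * g s \<partial>\<mu>)) = (\<integral>s. (\<Sum>i<k. v $ i * (ph i s * g s)) \<partial>\<mu>)"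
    by simp
  also have "\<dots> = (\<integral>s. lincomb k ph v s * g s \<partial>\<mu>)"
    by (simp add: lincomb_def sum_distrib_left mult_ac)
  finally show ?thesis by simp
qed

lemma lincomb_diff:
  assumes "v \<in> carrier_vec k" "w \<in> carrier_vec k"
  shows "lincomb k ph (v - w) s = lincomb k ph v s - lincomb k ph w s"
proof -
  have "(\<Sum>j<k. ph j s * (v - w) $ j) = (\<Sum>j<k. ph j s * v $ j - ph j s * w $ j)"
  proof (rule sum.cong)
    fix j assume "j \<in> {..<k}"
    then have "(v - w) $ j = v $ j - w $ j" using assms by simp
    then show "ph j s * (v - w) $ j = ph j s * v $ j - ph j s * w $ j"
      by (simp only: right_diff_distrib)
  qed simp
  then show ?thesis by (simp only: lincomb_def sum_subtractf)
qed

lemma Gram_carrier: "Gram \<mu> k ph \<in> carrier_mat k k"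
  by (simp add: Gram_def)

lemma Gram_mult_vec:
  assumes "v \<in> carrier_vec k" "i < k"
  shows "(Gram \<mu> k ph *\<^sub>v v) $ i = (\<integral>s. ph i s * lincomb k ph v s \<partial>\<mu>)"
proof -
  have "(Gram \<mu> k ph *\<^sub>v v) $ i = (\<Sum>j<k. v $ j * (\<integral>s. ph j s * ph i s \<partial>\<mu>))"
    using assms by (subst index_mult_mat_vec_lessThan[OF Gram_carrier]) (auto simp: Gram_def mult_ac)
  also have "\<dots> = (\<integral>s. lincomb k ph v s * ph i s \<partial>\<mu>)"
    using assms by (intro integral_lincomb_mult[symmetric] bounded_measurable_square_integrable bounded_measurable_ph) auto
  finally show ?thesis by (simp add: mult.commute)
qed

lemma Gram_form:
  "(\<Sum>i<k. \<Sum>j<k. w i * Gram \<mu> k ph $$ (i,j) * w j) = (\<integral>s. (lincomb k ph (vec k w) s)\<^sup>2 \<partial>\<mu>)"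
proof -
  have v: "vec k w \<in> carrier_vec k" by simp
  have "(\<integral>s. lincomb k ph (vec k w) s * lincomb k ph (vec k w) s \<partial>\<mu>)
      = (\<Sum>i<k. vec k w $ i * (\<integral>s. ph i s * lincomb k ph (vec k w) s \<partial>\<mu>))"
    by (rule integral_lincomb_mult[OF measurable_lincomb square_integrable_lincomb])
  also have "\<dots> = (\<Sum>i<k. w i * (\<Sum>j<k. Gram \<mu> k ph $$ (i,j) * w j))"
  proof (intro sum.cong refl)
    fix i assume "i \<in> {..<k}"
    then have i: "i < k" by simp
    have "(\<integral>s. ph i s * lincomb k ph (vec k w) s \<partial>\<mu>) = (\<Sum>j<k. Gram \<mu> k ph $$ (i,j) * vec k w $ j)"
      unfolding Gram_mult_vec[OF v i, symmetric] by (rule index_mult_mat_vec_lessThan[OF Gram_carrier v i])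
    then show "vec k w $ i * (\<integral>s. ph i s * lincomb k ph (vec k w) s \<partial>\<mu>) = w i * (\<Sum>j<k. Gram \<mu> k ph $$ (i,j) * w j)"
      using i by simp
  qed
  finally show ?thesis by (simp add: power2_eq_square sum_distrib_left mult.assoc)
qed

lemma Gram_coercive: "c * (\<Sum>i<k. (w i)\<^sup>2) \<le> (\<Sum>i<k. \<Sum>j<k. w i * Gram \<mu> k ph $$ (i,j) * w j)"
  by (rule quadratic_form_ge_least_eigenvalue[OF Gram_carrier _ eig]) (auto simp: Gram_def mult.commute)

text \<open>Pointwise Cauchy-Schwarz in the coefficients. The factor \<open>k\<close> is what turns
  the rate sqrt(k/n) of the coefficients into k / sqrt n for the function.\<close>

lemma square_lincomb_le:
  "(\<integral>s. (lincomb k ph v s)\<^sup>2 \<partial>\<mu>) \<le> real k * b\<^sup>2 * (\<Sum>i<k. (v $ i)\<^sup>2)"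
proof (rule integral_le_const[OF square_integrable_lincomb], rule AE_I2)
  fix s
  have "(lincomb k ph v s)\<^sup>2 \<le> (\<Sum>i<k. (ph i s)\<^sup>2) * (\<Sum>i<k. (v $ i)\<^sup>2)"
    unfolding lincomb_def by (rule Cauchy_Schwarz_ineq_sum)
  also have "\<dots> \<le> (\<Sum>i<k. b\<^sup>2) * (\<Sum>i<k. (v $ i)\<^sup>2)"
  proof (intro mult_right_mono sum_mono sum_nonneg)
    show "(ph i s)\<^sup>2 \<le> b\<^sup>2" if "i \<in> {..<k}" for i
      using power_mono[OF ph_bound[of i s], of 2] that by simp
  qed simp
  finally show "(lincomb k ph v s)\<^sup>2 \<le> real k * b\<^sup>2 * (\<Sum>i<k. (v $ i)\<^sup>2)" by simp
qed

section \<open>The Galerkin matrix of the operator I - beta K\<close>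

lemma Bmat_carrier: "Bmat \<mu> K \<beta> k ph \<in> carrier_mat k k"
  by (simp add: Bmat_def)

lemma Bmat_mult_vec:
  assumes v: "v \<in> carrier_vec k" and i: "i < k"
  shows "(Bmat \<mu> K \<beta> k ph *\<^sub>v v) $ i =
    (\<integral>s. ph i s * (lincomb k ph v s - \<beta> * (\<integral>s'. lincomb k ph v s' \<partial>K s)) \<partial>\<mu>)"
proof -
  let ?g = "\<lambda>j s. ph i s * (ph j s - \<beta> * (\<integral>s'. ph j s' \<partial>K s))"
  have "(Bmat \<mu> K \<beta> k ph *\<^sub>v v) $ i = (\<Sum>j<k. (\<integral>s. ?g j s \<partial>\<mu>) * v $ j)"
    unfolding index_mult_mat_vec_lessThan[OF Bmat_carrier v i]
  proof (intro sum.cong refl)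
    fix j assume "j \<in> {..<k}"
    then have j: "j < k" by simp
    show "Bmat \<mu> K \<beta> k ph $$ (i, j) * v $ j = (\<integral>s. ?g j s \<partial>\<mu>) * v $ j"
      using i j Epair_residual[OF bounded_measurable_ph[OF j] bounded_measurable_ph[OF j], of "ph i" "-\<beta>"]
      by (simp add: Bmat_def)
  qed
  also have "\<dots> = (\<integral>s. (\<Sum>j<k. ?g j s * v $ j) \<partial>\<mu>)"
  proof -
    have "integrable \<mu> (?g j)" if "j < k" for j
      using that i by (intro bounded_measurable_integrable bounded_measurable_intros bounded_measurable_ph)
    then show ?thesis by simp
  qed
  also have "\<dots> = (\<integral>s. ph i s * (lincomb k ph v s - \<beta> * (\<integral>s'. lincomb k ph v s' \<partial>K s)) \<partial>\<mu>)"
  proof (rule Bochner_Integration.integral_cong)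
    fix s assume s: "s \<in> space \<mu>"
    have "(\<integral>s'. lincomb k ph v s' \<partial>K s) = (\<Sum>j<k. (\<integral>s'. ph j s' \<partial>K s) * v $ j)"
      using bounded_measurable_integrable_K[OF bounded_measurable_ph s] by (simp add: lincomb_def)
    then show "(\<Sum>j<k. ?g j s * v $ j) = ph i s * (lincomb k ph v s - \<beta> * (\<integral>s'. lincomb k ph v s' \<partial>K s))"
      unfolding lincomb_def
      by (simp add: sum_distrib_left right_diff_distrib left_diff_distrib sum_subtractf mult_ac)
  qed simp
  finally show ?thesis .
qed

lemma integral_lincomb_residual:
  assumes v: "v \<in> carrier_vec k"
  shows "(\<integral>s. lincomb k ph w s * (lincomb k ph v s - \<beta> * (\<integral>s'. lincomb k ph v s' \<partial>K s)) \<partial>\<mu>)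
    = (\<Sum>i<k. w $ i * (Bmat \<mu> K \<beta> k ph *\<^sub>v v) $ i)"
proof -
  have bm: "bounded_measurable (\<lambda>s. lincomb k ph v s - \<beta> * (\<integral>s'. lincomb k ph v s' \<partial>K s))"
    by (intro bounded_measurable_intros bounded_measurable_lincomb)
  show ?thesis
    using integral_lincomb_mult[OF bounded_measurable_measurable[OF bm] bounded_measurable_square_integrable[OF bm]]
      Bmat_mult_vec[OF v] by simp
qed

text \<open>Kept in terms of the L^2 norm of the sieve function, before passing to |v|^2: the energy
  estimate for the sieve solution then does not involve \<open>c\<close>.\<close>

lemma residual_form_ge:
  "(1 - \<beta>) * (\<integral>s. (lincomb k ph v s)\<^sup>2 \<partial>\<mu>)
    \<le> (\<integral>s. lincomb k ph v s * (lincomb k ph v s - \<beta> * (\<integral>s'. lincomb k ph v s' \<partial>K s)) \<partial>\<mu>)"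
proof -
  let ?f = "lincomb k ph v" and ?k = "\<lambda>s. \<integral>s'. lincomb k ph v s' \<partial>K s"
  have "integrable \<mu> (\<lambda>s. ?f s * ?k s)"
    by (intro bounded_measurable_integrable bounded_measurable_intros bounded_measurable_lincomb)
  then have "(\<integral>s. ?f s * (?f s - \<beta> * ?k s) \<partial>\<mu>) = (\<integral>s. (?f s)\<^sup>2 \<partial>\<mu>) - \<beta> * (\<integral>s. ?f s * ?k s \<partial>\<mu>)"
    using square_integrable_lincomb[of v]
    by (simp add: right_diff_distrib power2_eq_square mult.left_commute[of _ \<beta>])
  moreover have "(\<integral>s. ?f s * ?k s \<partial>\<mu>) \<le> (\<integral>s. (?f s)\<^sup>2 \<partial>\<mu>)"
    using cross_integral_K_le[of ?f ?f] square_integrable_lincomb[of v] by auto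
  then have "\<beta> * (\<integral>s. ?f s * ?k s \<partial>\<mu>) \<le> \<beta> * (\<integral>s. (?f s)\<^sup>2 \<partial>\<mu>)"
    using beta by (intro mult_left_mono) auto
  ultimately show ?thesis by (simp add: algebra_simps)
qed

lemma Bmat_coercive:
  "(1 - \<beta>) * c * (\<Sum>i<k. (w i)\<^sup>2) \<le> (\<Sum>i<k. \<Sum>j<k. w i * Bmat \<mu> K \<beta> k ph $$ (i,j) * w j)"
proof -
  have "(1 - \<beta>) * (c * (\<Sum>i<k. (w i)\<^sup>2)) \<le> (1 - \<beta>) * (\<integral>s. (lincomb k ph (vec k w) s)\<^sup>2 \<partial>\<mu>)"
    using Gram_coercive beta unfolding Gram_form by (intro mult_left_mono) auto
  also have "\<dots> \<le> (\<Sum>i<k. vec k w $ i * (Bmat \<mu> K \<beta> k ph *\<^sub>v vec k w) $ i)"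
    using residual_form_ge[of "vec k w"] by (simp add: integral_lincomb_residual)
  also have "\<dots> = (\<Sum>i<k. w i * (\<Sum>j<k. Bmat \<mu> K \<beta> k ph $$ (i,j) * w j))"
  proof (intro sum.cong refl)
    fix i assume "i \<in> {..<k}"
    then have i: "i < k" by simp
    show "vec k w $ i * (Bmat \<mu> K \<beta> k ph *\<^sub>v vec k w) $ i = w i * (\<Sum>j<k. Bmat \<mu> K \<beta> k ph $$ (i,j) * w j)"
      using i by (simp add: index_mult_mat_vec_lessThan[OF Bmat_carrier _ i] del: index_mult_mat_vec)
  qed
  finally show ?thesis by (simp add: sum_distrib_left mult.assoc)
qed

lemma coercivity_pos: "0 < (1 - \<beta>) * c"
  using beta c by simp

lemma invertible_Gram: "invertible_mat (Gram \<mu> k ph)"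
  by (rule coercive_invertible_mat[OF Gram_carrier c Gram_coercive])

lemma invertible_Bmat: "invertible_mat (Bmat \<mu> K \<beta> k ph)"
  by (rule coercive_invertible_mat[OF Bmat_carrier coercivity_pos Bmat_coercive])

text \<open>The quadratic form has the wrong sign for the coercivity criterion, so triviality of the
  kernel is taken over from \<open>Bmat\<close>.\<close>

lemma invertible_Amat: "invertible_mat (Amat \<mu> K \<beta> k ph)"
proof (rule invertible_mat_if_injective)
  show A: "Amat \<mu> K \<beta> k ph \<in> carrier_mat k k" by (simp add: Amat_def)
  fix v assume v: "v \<in> carrier_vec k" and Av: "Amat \<mu> K \<beta> k ph *\<^sub>v v = 0\<^sub>v k"
  have AB: "Amat \<mu> K \<beta> k ph $$ (i,j) = - Bmat \<mu> K \<beta> k ph $$ (i,j)" if "i < k" "j < k" for i j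
  proof -
    have "Epair \<mu> K (\<lambda>s s'. ph i s * (\<beta> * ph j s' - ph j s)) = - Epair \<mu> K (\<lambda>s s'. ph i s * (ph j s - \<beta> * ph j s'))"
      unfolding Epair_def by (simp flip: integral_minus add: algebra_simps)
    then show ?thesis using that by (simp add: Amat_def Bmat_def)
  qed
  have "(Bmat \<mu> K \<beta> k ph *\<^sub>v v) $ i = 0" if i: "i < k" for i
  proof -
    have "(Bmat \<mu> K \<beta> k ph *\<^sub>v v) $ i = (\<Sum>j<k. - (Amat \<mu> K \<beta> k ph $$ (i,j) * v $ j))"
      unfolding index_mult_mat_vec_lessThan[OF Bmat_carrier v i] using AB i by (intro sum.cong) auto
    also have "\<dots> = - (Amat \<mu> K \<beta> k ph *\<^sub>v v) $ i"
      unfolding index_mult_mat_vec_lessThan[OF A v i] by (simp add: sum_negf)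
    finally show ?thesis using Av i by simp
  qed
  then have "eucl_norm (Bmat \<mu> K \<beta> k ph *\<^sub>v v) = 0"
    using Bmat_carrier by (simp add: eucl_norm_def)
  then have "eucl_norm v \<le> 0"
    using coercive_eucl_norm_le[OF Bmat_carrier coercivity_pos v Bmat_coercive] by simp
  then have "(\<Sum>j<k. (v $ j)\<^sup>2) = 0"
    using v by (simp add: eucl_norm_def order_antisym sum_nonneg)
  then have "v $ j = 0" if "j < k" for j
    using that by (auto simp: sum_nonneg_eq_0_iff)
  then show "v = 0\<^sub>v k" using v by (intro eq_vecI) auto
qed

section \<open>The Galerkin solution: approximation error and energy bound\<close>

lemma omega_star_eq: "omega_star \<mu> K \<beta> k ph z = minv (Bmat \<mu> K \<beta> k ph) *\<^sub>v vec k (\<lambda>i. \<integral>s. ph i s * z s \<partial>\<mu>)"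
  by (simp add: omega_star_def Bmat_def)

lemma omega_star_carrier: "omega_star \<mu> K \<beta> k ph z \<in> carrier_vec k"
  unfolding omega_star_eq by (rule minv_solves(1)[OF Bmat_carrier invertible_Bmat]) simp

lemma Bmat_omega_star: "Bmat \<mu> K \<beta> k ph *\<^sub>v omega_star \<mu> K \<beta> k ph z = vec k (\<lambda>i. \<integral>s. ph i s * z s \<partial>\<mu>)"
  unfolding omega_star_eq by (rule minv_solves(2)[OF Bmat_carrier invertible_Bmat]) simp

text \<open>The equation for \<open>omega_star\<close> in weak form: \<open>f\<close> solves (I -
  beta K) f = z when tested against the span of the basis.\<close>

lemma galerkin:
  assumes "z \<in> borel_measurable \<mu>" "integrable \<mu> (\<lambda>s. (z s)\<^sup>2)"
  defines "f \<equiv> lincomb k ph (omega_star \<mu> K \<beta> k ph z)"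
  shows "(\<integral>s. lincomb k ph w s * (f s - \<beta> * (\<integral>s'. f s' \<partial>K s)) \<partial>\<mu>) = (\<integral>s. lincomb k ph w s * z s \<partial>\<mu>)"
  unfolding f_def integral_lincomb_residual[OF omega_star_carrier] integral_lincomb_mult[OF assms(1,2)]
    Bmat_omega_star by simp

text \<open>The normal equations: \<open>Gram\<close> times the coefficient vector reproduces the
  inner products with h.\<close>

lemma Pphi_orthogonal:
  assumes h [measurable]: "h \<in> borel_measurable \<mu>" and h2: "integrable \<mu> (\<lambda>s. (h s)\<^sup>2)"
  obtains w where "w \<in> carrier_vec k" "Pphi \<mu> k ph h = lincomb k ph w"
    "\<And>v. (\<integral>s. lincomb k ph v s * (h s - lincomb k ph w s) \<partial>\<mu>) = 0"
proof -
  define w where "w = minv (Gram \<mu> k ph) *\<^sub>v vec k (\<lambda>i. \<integral>s. ph i s * h s \<partial>\<mu>)"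
  have w: "w \<in> carrier_vec k" and Gw: "Gram \<mu> k ph *\<^sub>v w = vec k (\<lambda>i. \<integral>s. ph i s * h s \<partial>\<mu>)"
    unfolding w_def using minv_solves[OF Gram_carrier invertible_Gram] by auto
  have "(\<integral>s. lincomb k ph v s * (h s - lincomb k ph w s) \<partial>\<mu>) = 0" for v
  proof -
    have "(\<integral>s. lincomb k ph v s * (h s - lincomb k ph w s) \<partial>\<mu>)
        = (\<integral>s. lincomb k ph v s * h s \<partial>\<mu>) - (\<integral>s. lincomb k ph v s * lincomb k ph w s \<partial>\<mu>)"
      using integrable_mult_if_square_integrable[OF measurable_lincomb h square_integrable_lincomb h2, of v]
        integrable_mult_if_square_integrable[OF measurable_lincomb measurable_lincomb square_integrable_lincomb square_integrable_lincomb, of v w]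
      by (simp add: right_diff_distrib)
    also have "\<dots> = (\<Sum>i<k. v $ i * (\<integral>s. ph i s * h s \<partial>\<mu>)) - (\<Sum>i<k. v $ i * (Gram \<mu> k ph *\<^sub>v w) $ i)"
      using integral_lincomb_mult[OF h h2] integral_lincomb_mult[OF measurable_lincomb square_integrable_lincomb]
      by (simp add: Gram_mult_vec[OF w] del: index_mult_mat_vec)
    also have "\<dots> = 0" unfolding Gw by simp
    finally show ?thesis .
  qed
  then show ?thesis using w by (intro that[of w]) (auto simp: Pphi_def w_def)
qed

lemma approximation_error:
  assumes z: "z \<in> borel_measurable \<mu>" "integrable \<mu> (\<lambda>s. (z s)\<^sup>2)"
    and h [measurable]: "h \<in> borel_measurable \<mu>" and h2: "integrable \<mu> (\<lambda>s. (h s)\<^sup>2)"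
    and fix_h: "AE s in \<mu>. h s = z s + \<beta> * (\<integral>s'. h s' \<partial>K s)"
  shows "L2norm \<mu> (\<lambda>s. h s - lincomb k ph (omega_star \<mu> K \<beta> k ph z) s)
      \<le> L2norm \<mu> (\<lambda>s. h s - Pphi \<mu> k ph h s) / (1 - \<beta>)"
proof -
  define v where "v = omega_star \<mu> K \<beta> k ph z"
  have v: "v \<in> carrier_vec k" unfolding v_def by (rule omega_star_carrier)
  obtain w where w: "w \<in> carrier_vec k" and P: "Pphi \<mu> k ph h = lincomb k ph w"
    and orth: "\<And>v. (\<integral>s. lincomb k ph v s * (h s - lincomb k ph w s) \<partial>\<mu>) = 0"
    using Pphi_orthogonal[OF h h2] by blast
  define d where "d = lincomb k ph (v - w)"
  define e where "e = (\<lambda>s. h s - lincomb k ph v s)"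
  have dvw: "d s = lincomb k ph v s - lincomb k ph w s" for s
    unfolding d_def by (rule lincomb_diff[OF v w])
  have d_meas [measurable]: "d \<in> borel_measurable \<mu>" and d2: "integrable \<mu> (\<lambda>s. (d s)\<^sup>2)"
    unfolding d_def by (rule measurable_lincomb square_integrable_lincomb)+
  have e_meas [measurable]: "e \<in> borel_measurable \<mu>" unfolding e_def by measurable
  have e2: "integrable \<mu> (\<lambda>s. (e s)\<^sup>2)"
    unfolding e_def by (rule square_integrable_diff[OF h measurable_lincomb h2 square_integrable_lincomb])
  note k2 = square_integrable_integral_K[OF e_meas e2]
  note [simp] = integrable_mult_if_square_integrable[OF d_meas e_meas d2 e2]
    integrable_mult_if_square_integrable[OF d_meas measurable_integral_K[OF e_meas] d2 k2]
  \<comment> \<open>e + d is the projection residual of h, which is orthogonal to the span and in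
    particular to d.\<close>
  have ortho: "(\<integral>s. d s * e s \<partial>\<mu>) = - (\<integral>s. (d s)\<^sup>2 \<partial>\<mu>)"
  proof -
    have "0 = (\<integral>s. d s * (h s - lincomb k ph w s) \<partial>\<mu>)"
      unfolding d_def by (rule orth[symmetric])
    also have "\<dots> = (\<integral>s. d s * e s + (d s)\<^sup>2 \<partial>\<mu>)"
      by (rule Bochner_Integration.integral_cong) (simp_all add: dvw e_def algebra_simps power2_eq_square)
    also have "\<dots> = (\<integral>s. d s * e s \<partial>\<mu>) + (\<integral>s. (d s)\<^sup>2 \<partial>\<mu>)"
      using d2 by simp
    finally show ?thesis by simp
  qed
  \<comment> \<open>Galerkin orthogonality: (I - beta K) e is the residual of the fixed point
    equation at the sieve solution, and d is an admissible test function.\<close>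
  have gal: "(\<integral>s. d s * e s \<partial>\<mu>) = \<beta> * (\<integral>s. d s * (\<integral>s'. e s' \<partial>K s) \<partial>\<mu>)"
  proof -
    let ?r = "\<lambda>s. lincomb k ph v s - \<beta> * (\<integral>s'. lincomb k ph v s' \<partial>K s)"
    have r: "bounded_measurable ?r" by (intro bounded_measurable_intros bounded_measurable_lincomb)
    note r = bounded_measurable_measurable[OF r] bounded_measurable_square_integrable[OF r]
    \<comment> \<open>Only almost everywhere, both because the fixed point equation for h holds so
      and because h is integrable under \<open>K s\<close> for almost every
      \<open>s\<close>.\<close>
    have "AE s in \<mu>. e s - \<beta> * (\<integral>s'. e s' \<partial>K s) = z s - ?r s"
      using fix_h AE_integrable_K[OF h h2] AE_space
    proof eventually_elim
      case (elim s)
      have Ke: "(\<integral>s'. e s' \<partial>K s) = (\<integral>s'. h s' \<partial>K s) - (\<integral>s'. lincomb k ph v s' \<partial>K s)"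
        unfolding e_def
        using elim bounded_measurable_integrable_K[OF bounded_measurable_lincomb]
        by (intro Bochner_Integration.integral_diff) auto
      show ?case unfolding Ke using elim(1) by (simp add: e_def algebra_simps)
    qed
    then have "(\<integral>s. d s * (e s - \<beta> * (\<integral>s'. e s' \<partial>K s)) \<partial>\<mu>) = (\<integral>s. d s * (z s - ?r s) \<partial>\<mu>)"
      using z(1) r(1) by (intro integral_cong_AE) auto
    also have "\<dots> = (\<integral>s. d s * z s \<partial>\<mu>) - (\<integral>s. d s * ?r s \<partial>\<mu>)"
      using integrable_mult_if_square_integrable[OF d_meas z(1) d2 z(2)]
        integrable_mult_if_square_integrable[OF d_meas r(1) d2 r(2)]
      by (simp add: right_diff_distrib[of "d _" "z _"])
    also have "\<dots> = 0"
      using galerkin[OF z, of "v - w"] by (simp add: d_def v_def)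
    finally have "(\<integral>s. d s * e s - \<beta> * (d s * (\<integral>s'. e s' \<partial>K s)) \<partial>\<mu>) = 0"
      by (simp add: algebra_simps)
    then show ?thesis by simp
  qed
  define D E N where "D = (\<integral>s. (d s)\<^sup>2 \<partial>\<mu>)" and "E = (\<integral>s. (e s)\<^sup>2 \<partial>\<mu>)"
    and "N = (\<integral>s. (h s - lincomb k ph w s)\<^sup>2 \<partial>\<mu>)"
  have nonneg: "0 \<le> D" "0 \<le> E" "0 \<le> N" by (simp_all add: D_def E_def N_def)
  have N: "N = E - D"
  proof -
    have "N = (\<integral>s. (e s)\<^sup>2 + 2 * (d s * e s) + (d s)\<^sup>2 \<partial>\<mu>)"
      unfolding N_def
      by (rule Bochner_Integration.integral_cong) (simp_all add: dvw e_def algebra_simps power2_eq_square)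
    also have "\<dots> = E + 2 * (\<integral>s. d s * e s \<partial>\<mu>) + D"
      using d2 e2 by (simp add: D_def E_def)
    finally show ?thesis using ortho by (simp add: D_def)
  qed
  have "D = \<beta> * - (\<integral>s. d s * (\<integral>s'. e s' \<partial>K s) \<partial>\<mu>)"
    using ortho gal by (simp add: D_def)
  also have "\<dots> \<le> \<beta> * ((D + E) / 2)"
  proof (rule mult_left_mono)
    show "- (\<integral>s. d s * (\<integral>s'. e s' \<partial>K s) \<partial>\<mu>) \<le> (D + E) / 2"
      using cross_integral_K_le[OF d_meas d2 e_meas e2] unfolding D_def E_def by linarith
  qed (use beta in simp)
  finally have "D * (2 - \<beta>) \<le> \<beta> * E" by (simp add: field_simps)
  \<comment> \<open>By Pythagoras D is E - N. This bound on E / N is the actual outcome; the rest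
    relaxes it to 1 / (1 - beta)^2 by (1 - beta)(2 - beta) \<le> 2.\<close>
  then have "E * (2 * (1 - \<beta>)) \<le> N * (2 - \<beta>)" by (simp add: N algebra_simps)
  then have "(1 - \<beta>) * (E * (2 * (1 - \<beta>))) \<le> (1 - \<beta>) * (N * (2 - \<beta>))"
    using beta by (intro mult_left_mono) auto
  also have "\<dots> = N * ((1 - \<beta>) * (2 - \<beta>))" by simp
  also have "\<dots> \<le> N * 2"
  proof -
    have "(1 - \<beta>) * (2 - \<beta>) \<le> 1 * 2" using beta by (intro mult_mono) auto
    then show ?thesis using nonneg by (intro mult_left_mono) auto
  qed
  finally have "(1 - \<beta>) * (E * (2 * (1 - \<beta>))) \<le> N * 2" .
  moreover have "(1 - \<beta>) * (E * (2 * (1 - \<beta>))) = 2 * (E * (1 - \<beta>)\<^sup>2)"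
    by (simp only: power2_eq_square mult_ac)
  ultimately have "E * (1 - \<beta>)\<^sup>2 \<le> N" by linarith
  then have "sqrt (E * (1 - \<beta>)\<^sup>2) \<le> sqrt N" by (rule real_sqrt_le_mono)
  then have "sqrt E * (1 - \<beta>) \<le> sqrt N" using beta by (simp add: real_sqrt_mult)
  then have "sqrt E \<le> sqrt N / (1 - \<beta>)" using beta by (simp add: field_simps)
  then show ?thesis by (simp add: L2norm_def E_def N_def e_def v_def P)
qed

text \<open>A triangle inequality up to the factor 2, which is harmless for stochastic orders and
  lets squares be compared directly. The absolute value is there because \<open>b\<close> may be
  negative when \<open>k\<close> is 0.\<close>

lemma L2norm_lincomb_change:
  assumes h [measurable]: "h \<in> borel_measurable \<mu>" and h2: "integrable \<mu> (\<lambda>s. (h s)\<^sup>2)"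
    and v: "v \<in> carrier_vec k" and w: "w \<in> carrier_vec k"
  shows "L2norm \<mu> (\<lambda>s. h s - lincomb k ph w s)
    \<le> 2 * (L2norm \<mu> (\<lambda>s. h s - lincomb k ph v s) + sqrt (real k) * \<bar>b\<bar> * eucl_norm (w - v))"
proof -
  define x where "x = L2norm \<mu> (\<lambda>s. h s - lincomb k ph v s)"
  define y where "y = sqrt (real k) * \<bar>b\<bar> * eucl_norm (w - v)"
  have x: "0 \<le> x" "x\<^sup>2 = (\<integral>s. (h s - lincomb k ph v s)\<^sup>2 \<partial>\<mu>)" by (simp_all add: x_def L2norm_def)
  have "(eucl_norm (w - v))\<^sup>2 = (\<Sum>i<k. ((w - v) $ i)\<^sup>2)"
    using v w by (simp add: eucl_norm_def sum_nonneg)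
  then have y: "0 \<le> y" "y\<^sup>2 = real k * b\<^sup>2 * (\<Sum>i<k. ((w - v) $ i)\<^sup>2)"
    by (simp_all add: y_def power_mult_distrib eucl_norm_def sum_nonneg)
  have i1: "integrable \<mu> (\<lambda>s. (h s - lincomb k ph v s)\<^sup>2)"
    by (rule square_integrable_diff[OF h measurable_lincomb h2 square_integrable_lincomb])
  have "(\<integral>s. (h s - lincomb k ph w s)\<^sup>2 \<partial>\<mu>)
      \<le> (\<integral>s. 2 * (h s - lincomb k ph v s)\<^sup>2 + 2 * (lincomb k ph (w - v) s)\<^sup>2 \<partial>\<mu>)"
  proof (rule integral_mono)
    show "integrable \<mu> (\<lambda>s. (h s - lincomb k ph w s)\<^sup>2)"
      by (rule square_integrable_diff[OF h measurable_lincomb h2 square_integrable_lincomb])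
    show "integrable \<mu> (\<lambda>s. 2 * (h s - lincomb k ph v s)\<^sup>2 + 2 * (lincomb k ph (w - v) s)\<^sup>2)"
      using i1 square_integrable_lincomb by simp
    show "(h s - lincomb k ph w s)\<^sup>2 \<le> 2 * (h s - lincomb k ph v s)\<^sup>2 + 2 * (lincomb k ph (w - v) s)\<^sup>2" for s
      \<comment> \<open>The difference of the two sides is exactly the square given here
        (parallelogram identity).\<close>
      using zero_le_power2[of "(h s - lincomb k ph v s) + (lincomb k ph w s - lincomb k ph v s)"]
      unfolding lincomb_diff[OF w v] by (simp add: power2_eq_square algebra_simps)
  qed
  also have "\<dots> = 2 * x\<^sup>2 + 2 * (\<integral>s. (lincomb k ph (w - v) s)\<^sup>2 \<partial>\<mu>)"
    using i1 square_integrable_lincomb by (simp add: x(2))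
  also have "\<dots> \<le> 2 * x\<^sup>2 + 2 * y\<^sup>2"
    using square_lincomb_le[of "w - v"] by (simp add: y(2))
  also have "\<dots> \<le> (2 * (x + y))\<^sup>2"
    using x(1) y(1) by (simp add: power2_eq_square algebra_simps)
  finally have "L2norm \<mu> (\<lambda>s. h s - lincomb k ph w s) \<le> sqrt ((2 * (x + y))\<^sup>2)"
    unfolding L2norm_def by (rule real_sqrt_le_mono)
  then show ?thesis using x(1) y(1) by (simp add: x_def y_def)
qed

text \<open>Energy estimate: the Galerkin equation is tested with its own solution. The bound is
  free of \<open>k\<close>, which is what keeps the residual variance bounded as the sieve
  grows.\<close>

lemma square_norm_galerkin_le:
  assumes z: "z \<in> borel_measurable \<mu>" "\<And>s. \<bar>z s\<bar> \<le> L"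
  shows "(\<integral>s. (lincomb k ph (omega_star \<mu> K \<beta> k ph z) s)\<^sup>2 \<partial>\<mu>) \<le> L\<^sup>2 / (1 - \<beta>)\<^sup>2"
proof -
  let ?w = "omega_star \<mu> K \<beta> k ph z"
  let ?f = "lincomb k ph ?w"
  define F where "F = (\<integral>s. (?f s)\<^sup>2 \<partial>\<mu>)"
  define a where "a = 1 - \<beta>"
  have a: "0 < a" using beta by (simp add: a_def)
  have bm: "bounded_measurable z" using z by (intro bounded_measurableI) auto
  note z2 = bounded_measurable_square_integrable[OF bm]
  have "a * F \<le> (\<integral>s. ?f s * z s \<partial>\<mu>)"
    using residual_form_ge[of ?w] galerkin[OF z(1) z2, of ?w] by (simp add: F_def a_def)
  also have "\<dots> \<le> (\<integral>s. a / 2 * (?f s)\<^sup>2 + L\<^sup>2 / (2 * a) \<partial>\<mu>)"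
  proof (rule integral_mono)
    show "integrable \<mu> (\<lambda>s. ?f s * z s)"
      by (intro integrable_mult_if_square_integrable square_integrable_lincomb z2 z(1) measurable_lincomb)
    show "integrable \<mu> (\<lambda>s. a / 2 * (?f s)\<^sup>2 + L\<^sup>2 / (2 * a))"
      using square_integrable_lincomb by simp
    \<comment> \<open>Young's inequality with weight 1 - beta, so that half of the left-hand side a
      F absorbs the quadratic term.\<close>
    show "?f s * z s \<le> a / 2 * (?f s)\<^sup>2 + L\<^sup>2 / (2 * a)" for s
    proof -
      have "0 \<le> (a * ?f s - z s)\<^sup>2" by simp
      then have "2 * a * (?f s * z s) \<le> a\<^sup>2 * (?f s)\<^sup>2 + (z s)\<^sup>2"
        by (simp add: power2_diff power_mult_distrib mult_ac)
      also have "(z s)\<^sup>2 \<le> L\<^sup>2" using power_mono[OF z(2), of s 2] by simp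
      finally show ?thesis using a by (simp add: field_simps power2_eq_square)
    qed
  qed
  also have "\<dots> = a / 2 * F + L\<^sup>2 / (2 * a)"
    using square_integrable_lincomb prob_space by (simp add: F_def)
  finally have "F \<le> L\<^sup>2 / a\<^sup>2" using a by (simp add: field_simps power2_eq_square)
  then show ?thesis by (simp add: F_def a_def)
qed

end

subsection \<open>The empirical problem\<close>

lemma En_diff: "En Y T n \<omega> f - En Y T n \<omega> g = En Y T n \<omega> (\<lambda>s s'. f s s' - g s s')"
  by (simp add: En_def sum_subtractf diff_divide_distrib)

lemma En_sum: "(\<Sum>j\<in>J. En Y T n \<omega> (f j) * a j) = En Y T n \<omega> (\<lambda>s s'. \<Sum>j\<in>J. f j s s' * a j)"
proof -
  have "(\<Sum>i<n. \<Sum>t<T - 1. \<Sum>j\<in>J. f j (Y i t \<omega>) (Y i (Suc t) \<omega>) * a j)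
      = (\<Sum>i<n. \<Sum>j\<in>J. \<Sum>t<T - 1. f j (Y i t \<omega>) (Y i (Suc t) \<omega>) * a j)"
    by (intro sum.cong refl) (rule sum.swap)
  also have "\<dots> = (\<Sum>j\<in>J. \<Sum>i<n. \<Sum>t<T - 1. f j (Y i t \<omega>) (Y i (Suc t) \<omega>) * a j)"
    by (rule sum.swap)
  finally show ?thesis
    by (simp add: En_def sum_distrib_right sum_divide_distrib)
qed

lemma Bhat_carrier: "Bhat Y T \<beta> k ph n \<omega> \<in> carrier_mat k k"
  by (simp add: Bhat_def)

lemma Bhat_mult_vec:
  assumes v: "v \<in> carrier_vec k" and i: "i < k"
  shows "(Bhat Y T \<beta> k ph n \<omega> *\<^sub>v v) $ i =
    En Y T n \<omega> (\<lambda>s s'. ph i s * (lincomb k ph v s - \<beta> * lincomb k ph v s'))"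
proof -
  have "(Bhat Y T \<beta> k ph n \<omega> *\<^sub>v v) $ i = (\<Sum>j<k. En Y T n \<omega> (\<lambda>s s'. ph i s * (ph j s - \<beta> * ph j s')) * v $ j)"
    unfolding index_mult_mat_vec_lessThan[OF Bhat_carrier v i] using i by (simp add: Bhat_def)
  also have "\<dots> = En Y T n \<omega> (\<lambda>s s'. \<Sum>j<k. ph i s * (ph j s - \<beta> * ph j s') * v $ j)"
    by (rule En_sum)
  also have "(\<lambda>s s'. \<Sum>j<k. ph i s * (ph j s - \<beta> * ph j s') * v $ j)
      = (\<lambda>s s'. ph i s * (lincomb k ph v s - \<beta> * lincomb k ph v s'))"
    by (intro ext) (simp add: lincomb_def sum_distrib_left right_diff_distrib left_diff_distrib sum_subtractf mult_ac)
  finally show ?thesis .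
qed

text \<open>Exact algebra for any \<open>v\<close>. At the population coefficient the errors of
  matrix and right-hand side combine into a single empirical mean of a temporal difference
  residual.\<close>

lemma Bhat_estimation_error:
  assumes inv: "invertible_mat (Bhat Y T \<beta> k ph n \<omega>)" and v: "v \<in> carrier_vec k"
  shows "omega_hat Y T \<beta> k ph z n \<omega> \<in> carrier_vec k"
    and "Bhat Y T \<beta> k ph n \<omega> *\<^sub>v (omega_hat Y T \<beta> k ph z n \<omega> - v) =
      vec k (\<lambda>i. En Y T n \<omega> (\<lambda>s s'. ph i s * (z s - lincomb k ph v s + \<beta> * lincomb k ph v s')))"
proof -
  let ?B = "Bhat Y T \<beta> k ph n \<omega>" and ?w = "omega_hat Y T \<beta> k ph z n \<omega>"
  note sol = minv_solves[OF Bhat_carrier inv, of "vec k (\<lambda>i. En Y T n \<omega> (\<lambda>s s'. ph i s * z s))"]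
  show w: "?w \<in> carrier_vec k" unfolding omega_hat_def by (rule sol(1)) simp
  have Bw: "?B *\<^sub>v ?w = vec k (\<lambda>i. En Y T n \<omega> (\<lambda>s s'. ph i s * z s))"
    unfolding omega_hat_def by (rule sol(2)) simp
  have "?B *\<^sub>v (?w - v) = ?B *\<^sub>v ?w - ?B *\<^sub>v v"
    by (rule mult_minus_distrib_mat_vec[OF Bhat_carrier w v])
  also have "\<dots> = vec k (\<lambda>i. En Y T n \<omega> (\<lambda>s s'. ph i s * (z s - lincomb k ph v s + \<beta> * lincomb k ph v s')))"
  proof (rule eq_vecI)
    fix i assume "i < dim_vec (vec k (\<lambda>i. En Y T n \<omega> (\<lambda>s s'. ph i s * (z s - lincomb k ph v s + \<beta> * lincomb k ph v s'))))"
    then have i: "i < k" by simp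
    have "(?B *\<^sub>v ?w - ?B *\<^sub>v v) $ i = (?B *\<^sub>v ?w) $ i - (?B *\<^sub>v v) $ i"
      using i Bhat_carrier[of Y T \<beta> k ph n \<omega>] by (intro index_minus_vec(1)) simp
    also have "\<dots> = En Y T n \<omega> (\<lambda>s s'. ph i s * z s - ph i s * (lincomb k ph v s - \<beta> * lincomb k ph v s'))"
      unfolding Bw Bhat_mult_vec[OF v i] using i by (simp add: En_diff)
    also have "\<dots> = En Y T n \<omega> (\<lambda>s s'. ph i s * (z s - lincomb k ph v s + \<beta> * lincomb k ph v s'))"
      by (rule arg_cong[where f="En Y T n \<omega>"], intro ext) (simp add: algebra_simps)
    finally show "(?B *\<^sub>v ?w - ?B *\<^sub>v v) $ i = vec k (\<lambda>i. En Y T n \<omega> (\<lambda>s s'. ph i s * (z s - lincomb k ph v s + \<beta> * lincomb k ph v s'))) $ i"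
      using i by simp
  qed (use Bhat_carrier[of Y T \<beta> k ph n \<omega>] in auto)
  finally show "?B *\<^sub>v (?w - v) = vec k (\<lambda>i. En Y T n \<omega> (\<lambda>s s'. ph i s * (z s - lincomb k ph v s + \<beta> * lincomb k ph v s')))" .
qed

locale sieve_panel = sieve \<mu> K \<beta> k ph c b + markov_panel \<mu> K M Y T
  for \<mu> :: "'s measure" and K and \<beta> k ph c b and M :: "'w measure" and Y T +
  fixes z :: "'s \<Rightarrow> real" and L :: real
  assumes z_meas [measurable]: "z \<in> borel_measurable \<mu>" and z_bound: "\<And>s. \<bar>z s\<bar> \<le> L"
begin

section \<open>Moment conditions at the population coefficient\<close>

abbreviation w_star where "w_star \<equiv> omega_star \<mu> K \<beta> k ph z"
abbreviation f_star where "f_star \<equiv> lincomb k ph w_star"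

definition moment :: "nat \<Rightarrow> 's \<Rightarrow> 's \<Rightarrow> real" where
  "moment i s s' = ph i s * (z s - f_star s + \<beta> * f_star s')"

lemma bounded_measurable_z: "bounded_measurable z"
  using z_meas z_bound by (intro bounded_measurableI)

lemma moment_measurable: "case_prod (moment i) \<in> borel_measurable (\<mu> \<Otimes>\<^sub>M \<mu>)"
  unfolding moment_def by measurable

text \<open>Given \<open>s\<close> the residual need not have mean zero, as \<open>f_star\<close>
  only approximates h; orthogonality to each basis function is precisely the equation that defines
  \<open>w_star\<close>.\<close>

lemma Epair_moment: "i < k \<Longrightarrow> Epair \<mu> K (moment i) = 0"
proof -
  assume i: "i < k"
  have r: "bounded_measurable (\<lambda>s. f_star s - \<beta> * (\<integral>s'. f_star s' \<partial>K s))"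
    by (intro bounded_measurable_intros bounded_measurable_lincomb)
  have "Epair \<mu> K (moment i) = (\<integral>s. ph i s * (z s - f_star s + \<beta> * (\<integral>s'. f_star s' \<partial>K s)) \<partial>\<mu>)"
    unfolding moment_def
    by (rule Epair_residual) (intro bounded_measurable_intros bounded_measurable_z bounded_measurable_lincomb)+
  also have "\<dots> = (\<integral>s. ph i s * z s - ph i s * (f_star s - \<beta> * (\<integral>s'. f_star s' \<partial>K s)) \<partial>\<mu>)"
    by (rule Bochner_Integration.integral_cong) (simp_all add: algebra_simps)
  also have "\<dots> = (\<integral>s. ph i s * z s \<partial>\<mu>) - (\<integral>s. ph i s * (f_star s - \<beta> * (\<integral>s'. f_star s' \<partial>K s)) \<partial>\<mu>)"
    by (intro Bochner_Integration.integral_diff bounded_measurable_integrable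
        bounded_measurable_mult bounded_measurable_ph[OF i] bounded_measurable_z r)
  also have "\<dots> = (\<integral>s. ph i s * z s \<partial>\<mu>) - (Bmat \<mu> K \<beta> k ph *\<^sub>v w_star) $ i"
    unfolding Bmat_mult_vec[OF omega_star_carrier i] ..
  also have "\<dots> = 0" unfolding Bmat_omega_star using i by simp
  finally show ?thesis .
qed

text \<open>Qualitative: \<open>B\<close> may depend on \<open>k\<close>, and it supplies
  integrability without entering any rate.\<close>

lemma moment_bounded:
  obtains B where "\<And>i s s'. i < k \<Longrightarrow> s \<in> space \<mu> \<Longrightarrow> s' \<in> space \<mu> \<Longrightarrow> \<bar>moment i s s'\<bar> \<le> B"
proof -
  obtain F where F: "\<And>s. s \<in> space \<mu> \<Longrightarrow> \<bar>f_star s\<bar> \<le> F"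
    using bounded_measurable_lincomb[of w_star] by (auto simp: bounded_measurable_def)
  have "\<bar>moment i s s'\<bar> \<le> b * (L + F + F)" if "i < k" "s \<in> space \<mu>" "s' \<in> space \<mu>" for i s s'
  proof -
    have "\<bar>\<beta> * f_star s'\<bar> \<le> 1 * F"
      unfolding abs_mult using beta F[OF that(3)] by (intro mult_mono) auto
    then have "\<bar>z s - f_star s + \<beta> * f_star s'\<bar> \<le> L + F + F"
      using z_bound[of s] F[OF that(2)] by linarith
    then show ?thesis
      unfolding moment_def abs_mult using ph_bound[OF that(1), of s] by (intro mult_mono) auto
  qed
  then show ?thesis by (rule that)
qed

text \<open>The 9 is 3 times 3: the square of a three-term sum, and three second moments each at
  most L^2 / (1 - beta)^2. The values of \<open>f_star\<close> at both states have the same second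
  moment by stationarity.\<close>

lemma Epair_moment_square:
  assumes i: "i < k"
  shows "Epair \<mu> K (\<lambda>s s'. (moment i s s')\<^sup>2) \<le> 9 * b\<^sup>2 * L\<^sup>2 / (1 - \<beta>)\<^sup>2"
proof -
  obtain B where B: "\<And>i s s'. i < k \<Longrightarrow> s \<in> space \<mu> \<Longrightarrow> s' \<in> space \<mu> \<Longrightarrow> \<bar>moment i s s'\<bar> \<le> B"
    using moment_bounded by blast
  obtain F where F: "\<And>s. s \<in> space \<mu> \<Longrightarrow> \<bar>f_star s\<bar> \<le> F"
    using bounded_measurable_lincomb[of w_star] by (auto simp: bounded_measurable_def)
  have F2: "(f_star s)\<^sup>2 \<le> F\<^sup>2" if "s \<in> space \<mu>" for s
    using power_mono[OF F[OF that], of 2] by simp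
  define G where "G = (\<integral>s. (f_star s)\<^sup>2 \<partial>\<mu>)"
  have sq: "bounded_measurable (\<lambda>s. (f_star s)\<^sup>2)"
    unfolding power2_eq_square by (intro bounded_measurable_intros bounded_measurable_lincomb)
  \<comment> \<open>The grouping and the factor 1 are chosen to match the shape of
    \<open>Epair_residual\<close>.\<close>
  let ?g = "\<lambda>s s'. 3 * b\<^sup>2 * ((L\<^sup>2 + (f_star s)\<^sup>2) + 1 * (f_star s')\<^sup>2)"
  have "Epair \<mu> K (\<lambda>s s'. (moment i s s')\<^sup>2) \<le> Epair \<mu> K ?g"
  proof (rule Epair_mono)
    show "(\<lambda>(s, s'). (moment i s s')\<^sup>2) \<in> borel_measurable (\<mu> \<Otimes>\<^sub>M \<mu>)"
      unfolding moment_def by measurable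
    show "(\<lambda>(s, s'). ?g s s') \<in> borel_measurable (\<mu> \<Otimes>\<^sub>M \<mu>)" by measurable
    fix s s' assume s: "s \<in> space \<mu>" "s' \<in> space \<mu>"
    show "\<bar>(moment i s s')\<^sup>2\<bar> \<le> B\<^sup>2"
      using power_mono[OF B[OF i s], of 2] by simp
    show "\<bar>?g s s'\<bar> \<le> 3 * b\<^sup>2 * (L\<^sup>2 + F\<^sup>2 + F\<^sup>2)"
    proof -
      have "?g s s' \<le> 3 * b\<^sup>2 * (L\<^sup>2 + F\<^sup>2 + F\<^sup>2)"
        using F2[OF s(1)] F2[OF s(2)] by (intro mult_left_mono) auto
      then show ?thesis by simp
    qed
    show "(moment i s s')\<^sup>2 \<le> ?g s s'"
    proof -
      \<comment> \<open>The difference of the two sides is the sum of the three squares supplied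
        below.\<close>
      have "(x - y + t)\<^sup>2 \<le> 3 * (x\<^sup>2 + y\<^sup>2 + t\<^sup>2)" for x y t :: real
        using zero_le_power2[of "x + y"] zero_le_power2[of "x - t"] zero_le_power2[of "y + t"]
        by (simp add: power2_eq_square algebra_simps)
      then have "(z s - f_star s + \<beta> * f_star s')\<^sup>2 \<le> 3 * ((z s)\<^sup>2 + (f_star s)\<^sup>2 + (\<beta> * f_star s')\<^sup>2)" .
      also have "\<dots> \<le> 3 * (L\<^sup>2 + (f_star s)\<^sup>2 + (f_star s')\<^sup>2)"
      proof -
        have "(z s)\<^sup>2 \<le> L\<^sup>2" using power_mono[OF z_bound[of s], of 2] by simp
        moreover have "\<beta>\<^sup>2 * (f_star s')\<^sup>2 \<le> 1 * (f_star s')\<^sup>2"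
          using beta by (intro mult_right_mono power_le_one) auto
        ultimately show ?thesis by (simp add: power_mult_distrib)
      qed
      finally have u: "(z s - f_star s + \<beta> * f_star s')\<^sup>2 \<le> 3 * (L\<^sup>2 + (f_star s)\<^sup>2 + (f_star s')\<^sup>2)" .
      have "(ph i s)\<^sup>2 \<le> b\<^sup>2" using power_mono[OF ph_bound[OF i, of s], of 2] by simp
      then have "(moment i s s')\<^sup>2 \<le> b\<^sup>2 * (3 * (L\<^sup>2 + (f_star s)\<^sup>2 + (f_star s')\<^sup>2))"
        unfolding moment_def power_mult_distrib[of "ph i s"] using u by (intro mult_mono) auto
      then show ?thesis by (simp add: algebra_simps)
    qed
  qed
  also have "\<dots> = (\<integral>s. 3 * b\<^sup>2 * ((L\<^sup>2 + (f_star s)\<^sup>2) + 1 * (\<integral>s'. (f_star s')\<^sup>2 \<partial>K s)) \<partial>\<mu>)"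
    by (rule Epair_residual[OF _ sq]) (intro bounded_measurable_intros sq)
  also have "\<dots> = 3 * b\<^sup>2 * (L\<^sup>2 + G + G)"
  proof -
    have "(\<integral>s. \<integral>s'. (f_star s')\<^sup>2 \<partial>K s \<partial>\<mu>) = G"
      unfolding G_def using F2 by (intro integral_K_bounded[of _ "F\<^sup>2"]) auto
    then show ?thesis
      using bounded_measurable_integrable[OF sq] prob_space
        bounded_measurable_integrable[OF bounded_measurable_integral_K[OF sq]]
      by (simp add: G_def)
  qed
  also have "\<dots> \<le> 3 * b\<^sup>2 * (3 * (L\<^sup>2 / (1 - \<beta>)\<^sup>2))"
  proof (intro mult_left_mono)
    have "G \<le> L\<^sup>2 / (1 - \<beta>)\<^sup>2"
      unfolding G_def using z_bound by (intro square_norm_galerkin_le) auto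
    moreover have "L\<^sup>2 \<le> L\<^sup>2 / (1 - \<beta>)\<^sup>2"
    proof -
      have "(1 - \<beta>)\<^sup>2 \<le> 1" "0 < (1 - \<beta>)\<^sup>2" using beta by (auto intro: power_le_one)
      then show ?thesis using mult_left_mono[of "(1 - \<beta>)\<^sup>2" 1 "L\<^sup>2"] by (simp add: field_simps)
    qed
    ultimately show "L\<^sup>2 + G + G \<le> 3 * (L\<^sup>2 / (1 - \<beta>)\<^sup>2)" by simp
  qed simp
  finally show ?thesis by simp
qed

section \<open>Mean squares of the score and of the matrix error, and the good event\<close>

definition score_sq :: "nat \<Rightarrow> 'w \<Rightarrow> real" where
  "score_sq n \<omega> = (\<Sum>i<k. (En Y T n \<omega> (moment i))\<^sup>2)"

definition matrix_error_sq :: "nat \<Rightarrow> 'w \<Rightarrow> real" where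
  "matrix_error_sq n \<omega> = (\<Sum>i<k. \<Sum>j<k. (Bhat Y T \<beta> k ph n \<omega> $$ (i,j) - Bmat \<mu> K \<beta> k ph $$ (i,j))\<^sup>2)"

lemma
  assumes n: "0 < n"
  shows integrable_score_sq: "integrable M (score_sq n)"
    and expectation_score_sq: "M.expectation (score_sq n) \<le> real k * (9 * b\<^sup>2 * L\<^sup>2 / (1 - \<beta>)\<^sup>2) / real n"
proof -
  obtain B where B: "\<And>i s s'. i < k \<Longrightarrow> s \<in> space \<mu> \<Longrightarrow> s' \<in> space \<mu> \<Longrightarrow> \<bar>moment i s s'\<bar> \<le> B"
    using moment_bounded by blast
  have ms: "integrable M (\<lambda>\<omega>. (En Y T n \<omega> (moment i))\<^sup>2)"
    "M.expectation (\<lambda>\<omega>. (En Y T n \<omega> (moment i))\<^sup>2) \<le> Epair \<mu> K (\<lambda>s s'. (moment i s s')\<^sup>2) / real n"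
    if i: "i < k" for i
    using En_mean_square_centered[OF moment_measurable B[OF i] Epair_moment[OF i] n] by auto
  show "integrable M (score_sq n)"
    unfolding score_sq_def using ms(1) by (intro Bochner_Integration.integrable_sum) simp
  have "M.expectation (score_sq n) = (\<Sum>i<k. M.expectation (\<lambda>\<omega>. (En Y T n \<omega> (moment i))\<^sup>2))"
    unfolding score_sq_def using ms(1) by (intro Bochner_Integration.integral_sum) auto
  also have "\<dots> \<le> (\<Sum>i<k. 9 * b\<^sup>2 * L\<^sup>2 / (1 - \<beta>)\<^sup>2 / real n)"
  proof (rule sum_mono)
    fix i assume "i \<in> {..<k}"
    then have i: "i < k" by simp
    show "M.expectation (\<lambda>\<omega>. (En Y T n \<omega> (moment i))\<^sup>2) \<le> 9 * b\<^sup>2 * L\<^sup>2 / (1 - \<beta>)\<^sup>2 / real n"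
      using ms(2)[OF i] Epair_moment_square[OF i] by (rule order.trans[OF _ divide_right_mono]) auto
  qed
  finally show "M.expectation (score_sq n) \<le> real k * (9 * b\<^sup>2 * L\<^sup>2 / (1 - \<beta>)\<^sup>2) / real n"
    by simp
qed

text \<open>There are k^2 entries, each bounded by 2 b^2 and thus of mean square error at most 4 b^4
  / n; this produces the ratio k^2/n.\<close>

lemma
  assumes n: "0 < n"
  shows integrable_matrix_error_sq: "integrable M (matrix_error_sq n)"
    and expectation_matrix_error_sq: "M.expectation (matrix_error_sq n) \<le> 4 * b ^ 4 * (real k)\<^sup>2 / real n"
proof -
  let ?g = "\<lambda>i j s s'. ph i s * (ph j s - \<beta> * ph j s')"
  have gm: "case_prod (?g i j) \<in> borel_measurable (\<mu> \<Otimes>\<^sub>M \<mu>)" for i j by measurable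
  have gb: "\<bar>?g i j s s'\<bar> \<le> 2 * b\<^sup>2" if "i < k" "j < k" for i j s s'
  proof -
    have "\<bar>\<beta> * ph j s'\<bar> \<le> 1 * b"
      unfolding abs_mult using beta ph_bound[OF that(2), of s'] by (intro mult_mono) auto
    then have "\<bar>ph j s - \<beta> * ph j s'\<bar> \<le> b + b"
      using ph_bound[OF that(2), of s] by linarith
    then have "\<bar>?g i j s s'\<bar> \<le> b * (b + b)"
      unfolding abs_mult using ph_bound[OF that(1), of s] by (intro mult_mono) auto
    then show ?thesis by (simp add: power2_eq_square algebra_simps)
  qed
  define d where "d = (\<lambda>i j \<omega>. (En Y T n \<omega> (?g i j) - Epair \<mu> K (?g i j))\<^sup>2)"
  have ms: "integrable M (d i j)" "M.expectation (d i j) \<le> (2 * b\<^sup>2)\<^sup>2 / real n" if "i < k" "j < k" for i j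
    unfolding d_def using En_mean_square[OF gm gb[OF that] n] by auto
  have eq: "matrix_error_sq n = (\<lambda>\<omega>. \<Sum>i<k. \<Sum>j<k. d i j \<omega>)"
    by (simp add: matrix_error_sq_def d_def fun_eq_iff Bhat_def Bmat_def)
  show "integrable M (matrix_error_sq n)"
    unfolding eq using ms(1) by (intro Bochner_Integration.integrable_sum) simp
  have "M.expectation (matrix_error_sq n) = (\<Sum>i<k. M.expectation (\<lambda>\<omega>. \<Sum>j<k. d i j \<omega>))"
    unfolding eq using ms(1)
    by (intro Bochner_Integration.integral_sum Bochner_Integration.integrable_sum) simp
  also have "\<dots> = (\<Sum>i<k. \<Sum>j<k. M.expectation (d i j))"
    using ms(1) by (intro sum.cong refl Bochner_Integration.integral_sum) simp
  also have "\<dots> \<le> (\<Sum>i<k. \<Sum>j<k. (2 * b\<^sup>2)\<^sup>2 / real n)"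
    using ms(2) by (intro sum_mono) auto
  also have "\<dots> = 4 * b ^ 4 * (real k)\<^sup>2 / real n"
    by (simp add: power_mult_distrib power2_eq_square power4_eq_xxxx)
  finally show "M.expectation (matrix_error_sq n) \<le> 4 * b ^ 4 * (real k)\<^sup>2 / real n" .
qed

text \<open>The threshold is half the coercivity constant of the population matrix, so the other
  half remains for the empirical one. Everything here is deterministic at a fixed
  \<open>\<omega>\<close>.\<close>

lemma estimation_error_on_good_event:
  assumes small: "matrix_error_sq n \<omega> \<le> ((1 - \<beta>) * c / 2)\<^sup>2"
  shows "invertible_mat (Bhat Y T \<beta> k ph n \<omega>)"
    and "omega_hat Y T \<beta> k ph z n \<omega> \<in> carrier_vec k"
    and "eucl_norm (omega_hat Y T \<beta> k ph z n \<omega> - w_star) \<le> sqrt (score_sq n \<omega>) / ((1 - \<beta>) * c / 2)"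
proof -
  let ?B = "Bhat Y T \<beta> k ph n \<omega>" and ?\<delta> = "(1 - \<beta>) * c / 2"
  have \<delta>: "0 < ?\<delta>" using coercivity_pos by simp
  have coercive: "?\<delta> * (\<Sum>i<k. (w i)\<^sup>2) \<le> (\<Sum>i<k. \<Sum>j<k. w i * ?B $$ (i,j) * w j)" for w
  proof -
    have "((1 - \<beta>) * c - ?\<delta>) * (\<Sum>i<k. (w i)\<^sup>2) \<le> (\<Sum>i<k. \<Sum>j<k. w i * ?B $$ (i,j) * w j)"
      using small \<delta> by (intro coercive_perturb[OF Bmat_coercive]) (simp_all add: matrix_error_sq_def)
    moreover have "(1 - \<beta>) * c - ?\<delta> = ?\<delta>" by simp
    ultimately show ?thesis by (simp only:)
  qed
  show inv: "invertible_mat ?B" by (rule coercive_invertible_mat[OF Bhat_carrier \<delta> coercive])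
  note err = Bhat_estimation_error[OF inv omega_star_carrier]
  show w: "omega_hat Y T \<beta> k ph z n \<omega> \<in> carrier_vec k" by (rule err(1))
  have "eucl_norm (omega_hat Y T \<beta> k ph z n \<omega> - w_star)
      \<le> eucl_norm (?B *\<^sub>v (omega_hat Y T \<beta> k ph z n \<omega> - w_star)) / ?\<delta>"
    using w omega_star_carrier by (intro coercive_eucl_norm_le[OF Bhat_carrier \<delta> _ coercive]) auto
  also have "eucl_norm (?B *\<^sub>v (omega_hat Y T \<beta> k ph z n \<omega> - w_star)) = sqrt (score_sq n \<omega>)"
    unfolding err(2) by (simp add: eucl_norm_def score_sq_def moment_def[abs_def])
  finally show "eucl_norm (omega_hat Y T \<beta> k ph z n \<omega> - w_star) \<le> sqrt (score_sq n \<omega>) / ?\<delta>" .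
qed

text \<open>Markov's inequality for matrix error and score, and a union bound. The first failure
  term vanishes with k^2/n; the second is tuned through \<open>r\<close>. The exceptional set is
  built from two measurable quantities, so it is an event whatever the measurability of
  \<open>omega_hat\<close>.\<close>

lemma estimation_error_bound:
  assumes n: "0 < n" and r: "0 < r"
  obtains E where "E \<in> sets M"
    "measure M E \<le> 4 * b ^ 4 * (real k)\<^sup>2 / real n / ((1 - \<beta>) * c / 2)\<^sup>2
      + real k * (9 * b\<^sup>2 * L\<^sup>2 / (1 - \<beta>)\<^sup>2) / real n / r"
    "\<And>\<omega>. \<omega> \<in> space M - E \<Longrightarrow> invertible_mat (Bhat Y T \<beta> k ph n \<omega>)"
    "\<And>\<omega>. \<omega> \<in> space M - E \<Longrightarrow> omega_hat Y T \<beta> k ph z n \<omega> \<in> carrier_vec k"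
    "\<And>\<omega>. \<omega> \<in> space M - E \<Longrightarrow>
      eucl_norm (omega_hat Y T \<beta> k ph z n \<omega> - w_star) \<le> sqrt r / ((1 - \<beta>) * c / 2)"
proof -
  define \<delta> where "\<delta> = (1 - \<beta>) * c / 2"
  have \<delta>: "0 < \<delta>" using coercivity_pos by (simp add: \<delta>_def)
  let ?E1 = "{\<omega>\<in>space M. matrix_error_sq n \<omega> \<ge> \<delta>\<^sup>2}" and ?E2 = "{\<omega>\<in>space M. score_sq n \<omega> \<ge> r}"
  note [measurable] = borel_measurable_integrable[OF integrable_matrix_error_sq[OF n]]
    borel_measurable_integrable[OF integrable_score_sq[OF n]]
  have "measure M ?E1 \<le> M.expectation (matrix_error_sq n) / \<delta>\<^sup>2"
    using \<delta> by (intro integral_Markov_inequality_measure[OF integrable_matrix_error_sq[OF n], of "space M"])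
      (auto simp: matrix_error_sq_def sum_nonneg)
  also have "\<dots> \<le> 4 * b ^ 4 * (real k)\<^sup>2 / real n / \<delta>\<^sup>2"
    by (intro divide_right_mono expectation_matrix_error_sq n) simp
  finally have E1: "measure M ?E1 \<le> 4 * b ^ 4 * (real k)\<^sup>2 / real n / \<delta>\<^sup>2" .
  have "measure M ?E2 \<le> M.expectation (score_sq n) / r"
    using r by (intro integral_Markov_inequality_measure[OF integrable_score_sq[OF n], of "space M"])
      (auto simp: score_sq_def sum_nonneg)
  also have "\<dots> \<le> real k * (9 * b\<^sup>2 * L\<^sup>2 / (1 - \<beta>)\<^sup>2) / real n / r"
    using r by (intro divide_right_mono expectation_score_sq n) simp
  finally have E2: "measure M ?E2 \<le> real k * (9 * b\<^sup>2 * L\<^sup>2 / (1 - \<beta>)\<^sup>2) / real n / r" .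
  have good: "matrix_error_sq n \<omega> \<le> \<delta>\<^sup>2" "score_sq n \<omega> \<le> r" if "\<omega> \<in> space M - (?E1 \<union> ?E2)" for \<omega>
    using that by auto
  show ?thesis
  proof (rule that[of "?E1 \<union> ?E2"])
    show "?E1 \<union> ?E2 \<in> sets M" by measurable
    have "measure M (?E1 \<union> ?E2) \<le> measure M ?E1 + measure M ?E2"
      by (rule measure_Un_le) measurable
    then show "measure M (?E1 \<union> ?E2) \<le> 4 * b ^ 4 * (real k)\<^sup>2 / real n / ((1 - \<beta>) * c / 2)\<^sup>2
      + real k * (9 * b\<^sup>2 * L\<^sup>2 / (1 - \<beta>)\<^sup>2) / real n / r"
      using E1 E2 by (simp add: \<delta>_def)
  next
    fix \<omega> assume \<omega>: "\<omega> \<in> space M - (?E1 \<union> ?E2)"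
    note e = estimation_error_on_good_event[OF good(1)[OF \<omega>, unfolded \<delta>_def]]
    show "invertible_mat (Bhat Y T \<beta> k ph n \<omega>)" by (rule e(1))
    show "omega_hat Y T \<beta> k ph z n \<omega> \<in> carrier_vec k" by (rule e(2))
    have "sqrt (score_sq n \<omega>) / ((1 - \<beta>) * c / 2) \<le> sqrt r / ((1 - \<beta>) * c / 2)"
      using good(2)[OF \<omega>] coercivity_pos by (intro divide_right_mono) auto
    then show "eucl_norm (omega_hat Y T \<beta> k ph z n \<omega> - w_star) \<le> sqrt r / ((1 - \<beta>) * c / 2)"
      using e(3) by linarith
  qed
qed

end

section \<open>Passage to the limit in n\<close>

theorem theorem1:
  fixes M :: "'w measure"
    and \<mu> :: "('a::finite \<times> 'x::topological_space) measure"
    and K :: "'a \<times> 'x \<Rightarrow> ('a \<times> 'x) measure"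
    and Y :: "nat \<Rightarrow> nat \<Rightarrow> 'w \<Rightarrow> 'a \<times> 'x"
    and T :: nat and \<beta> :: real
    and z h :: "'a \<times> 'x \<Rightarrow> real"
    and k :: "nat \<Rightarrow> nat"
    and \<phi> :: "nat \<Rightarrow> nat \<Rightarrow> 'a \<times> 'x \<Rightarrow> real"
    and Xdom :: "'x set"
    and Mb C \<alpha> L :: real
  assumes M: "prob_space M"
    and mu: "prob_space \<mu>" "sets \<mu> = sets (count_space UNIV \<Otimes>\<^sub>M borel)"
    and K: "K \<in> \<mu> \<rightarrow>\<^sub>M prob_algebra \<mu>"
    and stationary: "\<forall>A\<in>sets \<mu>. measure \<mu> A = (\<integral>s. measure (K s) A \<partial>\<mu>)"
    and beta: "0 < \<beta>" "\<beta> < 1"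
    and T: "T \<ge> 2"
    and Y_meas: "\<And>i t. Y i t \<in> M \<rightarrow>\<^sub>M \<mu>"
    and Y_indep: "prob_space.indep_vars M (\<lambda>_. PiM {..<T} (\<lambda>_. \<mu>))
                    (\<lambda>i \<omega>. \<lambda>t\<in>{..<T}. Y i t \<omega>) UNIV"
    and Y_law: "\<And>i A. (\<forall>t<T. A t \<in> sets \<mu>) \<Longrightarrow>
                 measure M {\<omega>\<in>space M. \<forall>t<T. Y i t \<omega> \<in> A t}
                 = (\<integral>s. chain_fun K (map (\<lambda>t. indicator (A t)) [0..<T]) s \<partial>\<mu>)"
    and z_meas: "z \<in> borel_measurable \<mu>"
    and h_meas: "h \<in> borel_measurable \<mu>"
    and h_L2: "integrable \<mu> (\<lambda>s. (h s)\<^sup>2)"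
    and h_fix: "AE s in \<mu>. h s = z s + \<beta> * (\<integral>s'. h s' \<partial>K s)"
    and phi_meas: "\<And>n j. \<phi> n j \<in> borel_measurable \<mu>"
    and A1_i_indep: "\<And>n w. dim_vec w = k n \<Longrightarrow>
                       (\<forall>s. lincomb (k n) (\<phi> n) w s = 0) \<longleftrightarrow> w = 0\<^sub>v (k n)"
    and A1_i_eig: "\<exists>c>0. \<forall>n ev. eigenvalue (Gram \<mu> (k n) (\<phi> n)) ev \<longrightarrow> ev \<ge> c"
    and A1_ii: "\<And>n j s. j < k n \<Longrightarrow> \<bar>\<phi> n j s\<bar> \<le> Mb"
    and A1_iii: "\<alpha> > 0" "\<And>n. L2norm \<mu> (\<lambda>s. h s - Pphi \<mu> (k n) (\<phi> n) h s)
                                \<le> C * real (k n) powr (- \<alpha>)"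
    and A1_iv: "compact Xdom" "AE s in \<mu>. snd s \<in> Xdom" "\<And>s. \<bar>z s\<bar> \<le> L"
    and A1_v: "filterlim k at_top sequentially"
              "(\<lambda>n. real (k n) ^ 2 / real n) \<longlonglongrightarrow> 0"
  shows
    "(\<forall>n. invertible_mat (Amat \<mu> K \<beta> (k n) (\<phi> n)))
     \<and> wpa1 M (\<lambda>n \<omega>. invertible_mat (Bhat Y T \<beta> (k n) (\<phi> n) n \<omega>))
     \<and> (\<forall>n. L2norm \<mu> (\<lambda>s. h s - lincomb (k n) (\<phi> n) (omega_star \<mu> K \<beta> (k n) (\<phi> n) z) s)
              \<le> L2norm \<mu> (\<lambda>s. h s - Pphi \<mu> (k n) (\<phi> n) h s) / (1 - \<beta>)
          \<and> L2norm \<mu> (\<lambda>s. h s - Pphi \<mu> (k n) (\<phi> n) h s) / (1 - \<beta>)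
              \<le> C * real (k n) powr (- \<alpha>) / (1 - \<beta>))
     \<and> bigOp M (\<lambda>n \<omega>. eucl_norm (omega_hat Y T \<beta> (k n) (\<phi> n) z n \<omega>
                                  - omega_star \<mu> K \<beta> (k n) (\<phi> n) z))
             (\<lambda>n. sqrt (real (k n) / real n))
     \<and> bigOp M (\<lambda>n \<omega>. L2norm \<mu> (\<lambda>s. h s - lincomb (k n) (\<phi> n) (omega_hat Y T \<beta> (k n) (\<phi> n) z n \<omega>) s))
             (\<lambda>n. real (k n) / sqrt (real n) + real (k n) powr (- \<alpha>))"
proof -
  have sk: "stationary_kernel \<mu> K"
    using mu(1) K stationary by (auto intro!: stationary_kernel.intro stationary_kernel_axioms.intro)
  obtain c where c: "0 < c" and eig: "\<And>n e. eigenvalue (Gram \<mu> (k n) (\<phi> n)) e \<Longrightarrow> c \<le> e"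
    using A1_i_eig by blast
  have sieve: "sieve \<mu> K \<beta> (k n) (\<phi> n) c Mb" for n
    using beta phi_meas A1_ii c eig by (intro sieve.intro[OF sk] sieve_axioms.intro)
  have "markov_panel \<mu> K M Y T"
    using M T Y_meas Y_indep Y_law by (intro markov_panel.intro[OF sk] markov_panel_axioms.intro)
  then have panel: "sieve_panel \<mu> K \<beta> (k n) (\<phi> n) c Mb M Y T z L" for n
    using z_meas A1_iv(3) by (intro sieve_panel.intro[OF sieve] sieve_panel_axioms.intro)
  interpret M: prob_space M by (rule M)
  interpret stationary_kernel \<mu> K by (rule sk)

  have z2: "integrable \<mu> (\<lambda>s. (z s)\<^sup>2)"
    using bounded_measurableI[OF z_meas A1_iv(3)] by (rule bounded_measurable_square_integrable)
  have approx: "L2norm \<mu> (\<lambda>s. h s - lincomb (k n) (\<phi> n) (omega_star \<mu> K \<beta> (k n) (\<phi> n) z) s)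
      \<le> L2norm \<mu> (\<lambda>s. h s - Pphi \<mu> (k n) (\<phi> n) h s) / (1 - \<beta>)" for n
    by (rule sieve.approximation_error[OF sieve z_meas z2 h_meas h_L2 h_fix])
  have rate: "L2norm \<mu> (\<lambda>s. h s - Pphi \<mu> (k n) (\<phi> n) h s) / (1 - \<beta>)
      \<le> C * real (k n) powr (- \<alpha>) / (1 - \<beta>)" for n
    using A1_iii(2) beta by (intro divide_right_mono) auto

  define \<delta> where "\<delta> = (1 - \<beta>) * c / 2"
  define V where "V = 9 * Mb\<^sup>2 * L\<^sup>2 / (1 - \<beta>)\<^sup>2"
  have \<delta>: "0 < \<delta>" using beta c by (simp add: \<delta>_def)
  have V: "0 \<le> V" by (simp add: V_def)
  define good where "good = (\<lambda>B n \<omega>. invertible_mat (Bhat Y T \<beta> (k n) (\<phi> n) n \<omega>)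
    \<and> omega_hat Y T \<beta> (k n) (\<phi> n) z n \<omega> \<in> carrier_vec (k n)
    \<and> eucl_norm (omega_hat Y T \<beta> (k n) (\<phi> n) z n \<omega> - omega_star \<mu> K \<beta> (k n) (\<phi> n) z)
        \<le> B * sqrt (real (k n) / real n))"
  \<comment> \<open>One exceptional event serves all three probabilistic claims; \<open>B\<close>
    depends on \<open>\<epsilon>\<close> but not on n.\<close>
  have key: "\<exists>B\<ge>0. \<exists>N. \<forall>n\<ge>N. \<exists>E\<in>sets M. measure M E < \<epsilon> \<and> (\<forall>\<omega>\<in>space M - E. good B n \<omega>)"
    if \<epsilon>: "0 < \<epsilon>" for \<epsilon>
  proof -
    \<comment> \<open>Chosen so that V / B^2 is below half of \<open>\<epsilon>\<close>; the added 1
      keeps \<open>B\<close> positive when \<open>V\<close> is 0.\<close>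
    define B where "B = sqrt (2 * V / \<epsilon> + 1)"
    have B: "0 < B" "V / B\<^sup>2 < \<epsilon> / 2"
    proof -
      have pos: "0 < 2 * V / \<epsilon> + 1" using V \<epsilon> by (simp add: add_nonneg_pos)
      then show "0 < B" by (simp add: B_def)
      have "V < (2 * V / \<epsilon> + 1) * (\<epsilon> / 2)" using \<epsilon> by (simp add: field_simps)
      then show "V / B\<^sup>2 < \<epsilon> / 2" using pos by (simp add: B_def pos_divide_less_eq mult.commute)
    qed
    have "(\<lambda>n. 4 * Mb ^ 4 / \<delta>\<^sup>2 * (real (k n) ^ 2 / real n)) \<longlonglongrightarrow> 0"
      using tendsto_mult_right_zero[OF A1_v(2)] .
    then have "\<forall>\<^sub>F n in sequentially. 4 * Mb ^ 4 / \<delta>\<^sup>2 * (real (k n) ^ 2 / real n) < \<epsilon> / 2"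
      using \<epsilon> by (intro order_tendstoD(2)) auto
    \<comment> \<open>A positive dimension makes the threshold \<open>r\<close> below positive, as
      Markov's inequality requires.\<close>
    moreover have "\<forall>\<^sub>F n in sequentially. 1 \<le> k n"
      using A1_v(1) by (simp add: filterlim_at_top)
    moreover have "\<forall>\<^sub>F n in sequentially. 1 \<le> n" by (rule eventually_ge_at_top)
    ultimately have "\<forall>\<^sub>F n in sequentially. 4 * Mb ^ 4 / \<delta>\<^sup>2 * (real (k n) ^ 2 / real n) < \<epsilon> / 2 \<and> 1 \<le> k n \<and> 1 \<le> n"
      by eventually_elim simp
    then obtain N where N: "\<And>n. n \<ge> N \<Longrightarrow> 4 * Mb ^ 4 / \<delta>\<^sup>2 * (real (k n) ^ 2 / real n) < \<epsilon> / 2 \<and> 1 \<le> k n \<and> 1 \<le> n"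
      by (auto simp: eventually_sequentially)
    have "\<exists>E\<in>sets M. measure M E < \<epsilon> \<and> (\<forall>\<omega>\<in>space M - E. good (B / \<delta>) n \<omega>)" if "n \<ge> N" for n
    proof -
      have n: "0 < n" and kn: "0 < k n" and small: "4 * Mb ^ 4 / \<delta>\<^sup>2 * (real (k n) ^ 2 / real n) < \<epsilon> / 2"
        using N[OF that] by auto
      \<comment> \<open>Proportional to k/n, so that the score's failure probability reduces to V /
        B^2 for every n.\<close>
      define r where "r = B\<^sup>2 * (real (k n) / real n)"
      have r: "0 < r" using B(1) n kn by (simp add: r_def)
      have sqrt_r: "sqrt r = B * sqrt (real (k n) / real n)"
        unfolding r_def real_sqrt_mult using B(1) by simp
      obtain E where E: "E \<in> sets M"
        "measure M E \<le> 4 * Mb ^ 4 * (real (k n))\<^sup>2 / real n / \<delta>\<^sup>2 + real (k n) * V / real n / r"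
        and g: "\<And>\<omega>. \<omega> \<in> space M - E \<Longrightarrow> invertible_mat (Bhat Y T \<beta> (k n) (\<phi> n) n \<omega>)"
        "\<And>\<omega>. \<omega> \<in> space M - E \<Longrightarrow> omega_hat Y T \<beta> (k n) (\<phi> n) z n \<omega> \<in> carrier_vec (k n)"
        "\<And>\<omega>. \<omega> \<in> space M - E \<Longrightarrow>
          eucl_norm (omega_hat Y T \<beta> (k n) (\<phi> n) z n \<omega> - omega_star \<mu> K \<beta> (k n) (\<phi> n) z) \<le> sqrt r / \<delta>"
        using sieve_panel.estimation_error_bound[OF panel n r] unfolding \<delta>_def V_def by blast
      have "real (k n) * V / real n / r = V / B\<^sup>2"
        using n kn B(1) by (simp add: r_def field_simps)
      moreover have "4 * Mb ^ 4 * (real (k n))\<^sup>2 / real n / \<delta>\<^sup>2 = 4 * Mb ^ 4 / \<delta>\<^sup>2 * (real (k n) ^ 2 / real n)"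
        by (simp add: mult.commute)
      ultimately have "measure M E < \<epsilon>" using E(2) small B(2) by linarith
      moreover have "good (B / \<delta>) n \<omega>" if "\<omega> \<in> space M - E" for \<omega>
        using g[OF that] by (simp add: good_def sqrt_r)
      ultimately show ?thesis using E(1) by blast
    qed
    then show ?thesis using B(1) \<delta> by (intro exI[of _ "B / \<delta>"] conjI exI[of _ N]) auto
  qed

  have "wpa1 M (\<lambda>n \<omega>. invertible_mat (Bhat Y T \<beta> (k n) (\<phi> n) n \<omega>))"
    unfolding wpa1_def
  proof (intro allI impI)
    fix \<epsilon> :: real assume "0 < \<epsilon>"
    from key[OF this] obtain B N where N: "\<And>n. n \<ge> N \<Longrightarrow> \<exists>E\<in>sets M. measure M E < \<epsilon> \<and> (\<forall>\<omega>\<in>space M - E. good B n \<omega>)"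
      by blast
    show "\<exists>N. \<forall>n\<ge>N. \<exists>E\<in>sets M. E \<subseteq> {\<omega>\<in>space M. invertible_mat (Bhat Y T \<beta> (k n) (\<phi> n) n \<omega>)} \<and> 1 - \<epsilon> < measure M E"
    proof (intro exI[of _ N] allI impI)
      fix n assume "N \<le> n"
      from N[OF this] obtain E where E: "E \<in> sets M" "measure M E < \<epsilon>" "\<forall>\<omega>\<in>space M - E. good B n \<omega>"
        by blast
      then show "\<exists>E\<in>sets M. E \<subseteq> {\<omega>\<in>space M. invertible_mat (Bhat Y T \<beta> (k n) (\<phi> n) n \<omega>)} \<and> 1 - \<epsilon> < measure M E"
        by (intro bexI[of _ "space M - E"]) (auto simp: good_def M.prob_compl)
    qed
  qed
  \<comment> \<open>Reduces a stochastic order to a deterministic inequality on the good event, with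
    a constant that may depend on \<open>B\<close> but not on n.\<close>
  moreover have bigOpI: "bigOp M X r"
    if bound: "\<And>B. 0 \<le> B \<Longrightarrow> \<exists>B'. \<forall>n \<omega>. good B n \<omega> \<longrightarrow> \<bar>X n \<omega>\<bar> \<le> B' * r n" for X r
    unfolding bigOp_def
  proof (intro allI impI)
    fix \<epsilon> :: real assume "0 < \<epsilon>"
    from key[OF this] obtain B N where B: "0 \<le> B"
      and N: "\<And>n. n \<ge> N \<Longrightarrow> \<exists>E\<in>sets M. measure M E < \<epsilon> \<and> (\<forall>\<omega>\<in>space M - E. good B n \<omega>)"
      by blast
    obtain B' where B': "\<And>n \<omega>. good B n \<omega> \<Longrightarrow> \<bar>X n \<omega>\<bar> \<le> B' * r n" using bound[OF B] by blast
    show "\<exists>B N. \<forall>n\<ge>N. \<exists>E\<in>sets M. {\<omega>\<in>space M. B * r n < \<bar>X n \<omega>\<bar>} \<subseteq> E \<and> measure M E < \<epsilon>"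
    proof (intro exI[of _ B'] exI[of _ N] allI impI)
      fix n assume "N \<le> n"
      from N[OF this] obtain E where E: "E \<in> sets M" "measure M E < \<epsilon>" "\<forall>\<omega>\<in>space M - E. good B n \<omega>"
        by blast
      have "{\<omega>\<in>space M. B' * r n < \<bar>X n \<omega>\<bar>} \<subseteq> E" using B' E(3) by (auto simp: not_less[symmetric])
      then show "\<exists>E\<in>sets M. {\<omega>\<in>space M. B' * r n < \<bar>X n \<omega>\<bar>} \<subseteq> E \<and> measure M E < \<epsilon>" using E by blast
    qed
  qed
  have "bigOp M (\<lambda>n \<omega>. eucl_norm (omega_hat Y T \<beta> (k n) (\<phi> n) z n \<omega> - omega_star \<mu> K \<beta> (k n) (\<phi> n) z))
             (\<lambda>n. sqrt (real (k n) / real n))"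
  proof (rule bigOpI)
    fix B :: real
    have "0 \<le> eucl_norm v" for v by (simp add: eucl_norm_def sum_nonneg)
    then show "\<exists>B'. \<forall>n \<omega>. good B n \<omega> \<longrightarrow>
        \<bar>eucl_norm (omega_hat Y T \<beta> (k n) (\<phi> n) z n \<omega> - omega_star \<mu> K \<beta> (k n) (\<phi> n) z)\<bar> \<le> B' * sqrt (real (k n) / real n)"
      by (intro exI[of _ B]) (simp add: good_def)
  qed
  moreover have "bigOp M (\<lambda>n \<omega>. L2norm \<mu> (\<lambda>s. h s - lincomb (k n) (\<phi> n) (omega_hat Y T \<beta> (k n) (\<phi> n) z n \<omega>) s))
             (\<lambda>n. real (k n) / sqrt (real n) + real (k n) powr (- \<alpha>))"
  proof (rule bigOpI)
    fix B :: real assume B: "0 \<le> B"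
    \<comment> \<open>The 2 comes from \<open>L2norm_lincomb_change\<close>, the two summands from
      approximation and estimation error; absolute values make each summand nonnegative, so p and q
      can share one constant.\<close>
    define B' where "B' = 2 * (\<bar>C\<bar> / (1 - \<beta>) + \<bar>Mb\<bar> * B)"
    have "\<bar>L2norm \<mu> (\<lambda>s. h s - lincomb (k n) (\<phi> n) (omega_hat Y T \<beta> (k n) (\<phi> n) z n \<omega>) s)\<bar>
        \<le> B' * (real (k n) / sqrt (real n) + real (k n) powr (- \<alpha>))" if g: "good B n \<omega>" for n \<omega>
    proof -
      let ?w = "omega_hat Y T \<beta> (k n) (\<phi> n) z n \<omega>" and ?v = "omega_star \<mu> K \<beta> (k n) (\<phi> n) z"
      define p q where "p = real (k n) / sqrt (real n)" and "q = real (k n) powr (- \<alpha>)"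
      have pq: "0 \<le> p" "0 \<le> q" by (simp_all add: p_def q_def)
      have "sqrt (real (k n)) * \<bar>Mb\<bar> * eucl_norm (?w - ?v) \<le> sqrt (real (k n)) * \<bar>Mb\<bar> * (B * sqrt (real (k n) / real n))"
        using g by (intro mult_left_mono) (simp_all add: good_def)
      also have "\<dots> = \<bar>Mb\<bar> * B * p"
        by (simp add: p_def real_sqrt_divide)
      finally have e: "sqrt (real (k n)) * \<bar>Mb\<bar> * eucl_norm (?w - ?v) \<le> \<bar>Mb\<bar> * B * p" .
      have "C * q / (1 - \<beta>) \<le> \<bar>C\<bar> / (1 - \<beta>) * q"
        using pq beta by (simp add: divide_right_mono mult_right_mono)
      then have a: "L2norm \<mu> (\<lambda>s. h s - lincomb (k n) (\<phi> n) ?v s) \<le> \<bar>C\<bar> / (1 - \<beta>) * q"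
        using approx[of n] rate[of n] unfolding q_def by linarith
      have "L2norm \<mu> (\<lambda>s. h s - lincomb (k n) (\<phi> n) ?w s)
          \<le> 2 * (L2norm \<mu> (\<lambda>s. h s - lincomb (k n) (\<phi> n) ?v s) + sqrt (real (k n)) * \<bar>Mb\<bar> * eucl_norm (?w - ?v))"
        using g unfolding good_def
        by (intro sieve.L2norm_lincomb_change[OF sieve h_meas h_L2 sieve.omega_star_carrier[OF sieve]]) simp
      also have "\<dots> \<le> 2 * (\<bar>C\<bar> / (1 - \<beta>) * q + \<bar>Mb\<bar> * B * p)" using a e by simp
      also have "\<dots> \<le> B' * (p + q)"
      proof -
        have "0 \<le> \<bar>C\<bar> / (1 - \<beta>) * p" "0 \<le> \<bar>Mb\<bar> * B * q" using pq B beta by simp_all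
        then show ?thesis by (simp add: B'_def distrib_left distrib_right)
      qed
      finally show ?thesis by (simp add: L2norm_def p_def q_def)
    qed
    then show "\<exists>B'. \<forall>n \<omega>. good B n \<omega> \<longrightarrow>
        \<bar>L2norm \<mu> (\<lambda>s. h s - lincomb (k n) (\<phi> n) (omega_hat Y T \<beta> (k n) (\<phi> n) z n \<omega>) s)\<bar>
        \<le> B' * (real (k n) / sqrt (real n) + real (k n) powr (- \<alpha>))"
      by blast
  qed
  ultimately show ?thesis
    using sieve.invertible_Amat[OF sieve] approx rate by blast
qed

end
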